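(* Let $f$ be an isometry of $\mathbb{H}^2$ induced by $A$ in $GL(2,\mathbb{R})$, resp. $\mathbb{R}_+\times SU(1,1)$. Let $c(A)=\frac{(\mathrm{trace}\,A)^2}{\det A}$. Then $c(A)$ is a real number. I. Suppose $f$ is orientation-preserving. (i) If $|c(A)-2|<2$, then $f$ is a $1$-rotatory elliptic. (ii) If $|c(A)-2|>2$, then $f$ is a stretch. (iii) If $|c(A)-2|=2$ and $A\neq rI$, then $f$ is a translation. (iv) If $|c(A)-2|=2$ and $A=rI$, then $f$ is the identity. II. Suppose $f$ is orientation-reversing. Let $f$ be induced by $A$ in $GL(2,\mathbb{R})$, resp. $\mathbb{R}_+\times SU(1,1)$. Let $B=A\bar A$. (i) If $|c(B)-2|>2$, then $f$ is a $0$-rotatory hyperbolic inversion. (ii) If $B\neq rI$ and $|c(B)-2|<2$, then $f$ is a $1$-rotatory elliptic inversion. (iii) If $B=rI$, then $f$ is a $0$-rotatory elliptic inversion. In this case, $f$ is an inversion in a circle of $\hat{\mathbb{C}}$.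
   Context: $\hat{\mathbb{C}}=\mathbb{C}\cup\{\infty\}$; circles of $\hat{\mathbb{C}}$ include lines together with $\infty$. $\bar A$ is the entrywise complex conjugate of $A$, $I$ is the identity matrix, "$M=rI$" (resp. "$M\neq rI$") means that $M$ is (resp. is not) a scalar matrix, and $c(B)=\frac{(\mathrm{trace}\,B)^2}{\det B}$. $\mathbb{R}_+$ is the group of positive reals, $SU(1,1)=\left\{\begin{pmatrix}a&\bar c\\c&\bar a\end{pmatrix}: |a|^2-|c|^2=1\right\}$, and $\mathbb{R}_+\times SU(1,1)$ is regarded as the subgroup $\{tM: t>0,\ M\in SU(1,1)\}$ of $GL(2,\mathbb{C})$. In the upper half-plane model, for $A=\begin{pmatrix}a&b\\c&d\end{pmatrix}\in GL(2,\mathbb{R})$, the isometry of $\mathbb{H}^2$ induced by $A$ is $z\mapsto\frac{az+b}{cz+d}$ (orientation-preserving) if $\det A>0$, and $z\mapsto\frac{a\bar z+b}{c\bar z+d}$ (orientation-reversing) if $\det A<0$. In the disk model, $A\in\mathbb{R}_+\times SU(1,1)$ with entries $a,b,c,d$ induces the orientation-preserving isometry $z\mapsto\frac{az+b}{cz+d}$ and the orientation-reversing isometry $z\mapsto\frac{a\bar z+b}{c\bar z+d}$. Up to conjugation by Möbius transformations of $\hat{\mathbb{C}}$, a stretch is $w\mapsto\kappa w$ with $\kappa>0$ real, $\kappa\neq1$, and a translation is $w\mapsto w+\beta$, $\beta\ne0$. The "$k$-rotatory" terminology: let $\mathbb{V}$ be a real vector space of dimension $3$ with a quadratic form $Q$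 of signature $(1,2)$, and let $\mathbb{H}^2$ be one component of $\{Q=1\}$; isometries of $\mathbb{H}^2$ are identified with the elements $T\in O(Q)$ preserving this component. $T$ is elliptic if it has an eigenvector $v$ with $Q(v)>0$, and hyperbolic if it has a real eigenvalue $r\ne\pm1$. Its characteristic polynomial is $(x-1)^l(x+1)^m\prod_{j=1}^s(x^2-2a_jx+1)^{r_j}$ in the elliptic case, and the same with an extra factor $(x-r)(x-r^{-1})$ in the hyperbolic case, with distinct real $a_j$, $|a_j|<1$. Put $k=\sum_jr_j+[\frac m2]$. $T$ is a $k$-rotatory elliptic / hyperbolic if $m$ is even, and a $k$-rotatory elliptic / hyperbolic inversion if $m$ is odd.
   Formalization: In I(iii) the printed claim fails when c(A)=0 (trace A=0), where f is a half-turn, e.g. z -> -1/z, and not a translation; the formal statement concludes in that case that f is a 1-rotatory elliptic, and otherwise that f is a translation. *)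

theory Defs
  imports "HOL-Analysis.Analysis" "HOL-Computational_Algebra.Polynomial"
begin

section \<open>The Riemann sphere and its Moebius maps\<close>

text \<open>\<^term>\<open>None\<close> is the point at infinity. Thus \<^term>\<open>map_option h\<close> is the extension of
  \<^term>\<open>h\<close> to the sphere that fixes infinity.\<close>

type_synonym riemann_sphere = "complex option"

fun moebius :: "complex^2^2 \<Rightarrow> riemann_sphere \<Rightarrow> riemann_sphere" where
  "moebius M (Some z) =
     (if M$2$1 * z + M$2$2 = 0 then None
      else Some ((M$1$1 * z + M$1$2) / (M$2$1 * z + M$2$2)))"
| "moebius M None = (if M$2$1 = 0 then None else Some (M$1$1 / M$2$1))"

definition moebius_conjugate ::
    "(riemann_sphere \<Rightarrow> riemann_sphere) \<Rightarrow> (riemann_sphere \<Rightarrow> riemann_sphere) \<Rightarrow> bool" where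
  "moebius_conjugate f h \<longleftrightarrow> (\<exists>M. det M \<noteq> 0 \<and> moebius M \<circ> f = h \<circ> moebius M)"

definition is_stretch :: "(riemann_sphere \<Rightarrow> riemann_sphere) \<Rightarrow> bool" where
  "is_stretch f \<longleftrightarrow>
     (\<exists>\<kappa>::real. \<kappa> > 0 \<and> \<kappa> \<noteq> 1 \<and> moebius_conjugate f (map_option (\<lambda>w. of_real \<kappa> * w)))"

definition is_translation :: "(riemann_sphere \<Rightarrow> riemann_sphere) \<Rightarrow> bool" where
  "is_translation f \<longleftrightarrow> (\<exists>\<beta>. \<beta> \<noteq> 0 \<and> moebius_conjugate f (map_option (\<lambda>w. w + \<beta>)))"

text \<open>\<^term>\<open>inversion_in C f\<close>: \<^term>\<open>f\<close> is the inversion in the circle \<^term>\<open>C\<close>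
  of the sphere, where lines through infinity count as circles.\<close>

inductive inversion_in ::
    "riemann_sphere set \<Rightarrow> (riemann_sphere \<Rightarrow> riemann_sphere) \<Rightarrow> bool" where
  circle: "r > 0 \<Longrightarrow>
     inversion_in (Some ` sphere p r)
       (\<lambda>w. case w of None \<Rightarrow> Some p
          | Some z \<Rightarrow> if z = p then None else Some (p + of_real (r^2) / cnj (z - p)))"
| line: "cmod u = 1 \<Longrightarrow>
     inversion_in (insert None (Some ` {p + of_real t * u |t. True}))
       (map_option (\<lambda>z. p + u^2 * cnj (z - p)))"


section \<open>Matrices and the maps they induce\<close>

definition is_scalar :: "complex^2^2 \<Rightarrow> bool" where
  "is_scalar M \<longleftrightarrow> (\<exists>r. M = mat r)"

definition matrix_cnj :: "complex^2^2 \<Rightarrow> complex^2^2" where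
  "matrix_cnj A = (\<chi> i j. cnj (A$i$j))"

definition c_inv :: "complex^2^2 \<Rightarrow> complex" where
  "c_inv B = (trace B)^2 / det B"

text \<open>The real general linear group, as a subgroup of the complex one.\<close>

definition GL2_real :: "(complex^2^2) set" where
  "GL2_real = {A. (\<forall>i j. A$i$j \<in> \<real>) \<and> det A \<noteq> 0}"

definition SU11 :: "(complex^2^2) set" where
  "SU11 = {vector [vector [a, cnj c], vector [c, cnj a]] |a c. (cmod a)^2 - (cmod c)^2 = 1}"

definition pos_SU11 :: "(complex^2^2) set" where
  "pos_SU11 = {t *\<^sub>R M |t M. t > 0 \<and> M \<in> SU11}"

datatype model = Half_Plane | Disk

fun points :: "model \<Rightarrow> complex set" where
  "points Half_Plane = {z. Im z > 0}"
| "points Disk = ball 0 1"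

text \<open>Induced isometries are regarded as maps of the whole sphere. A matrix in
  \<^const>\<open>GL2_real\<close> has a real determinant, whose sign decides the orientation; a matrix in
  \<^const>\<open>pos_SU11\<close> induces an isometry of either kind.\<close>

fun induces_preserving :: "model \<Rightarrow> complex^2^2 \<Rightarrow> (riemann_sphere \<Rightarrow> riemann_sphere) \<Rightarrow> bool" where
  "induces_preserving Half_Plane A f \<longleftrightarrow> A \<in> GL2_real \<and> Re (det A) > 0 \<and> f = moebius A"
| "induces_preserving Disk A f \<longleftrightarrow> A \<in> pos_SU11 \<and> f = moebius A"

fun induces_reversing :: "model \<Rightarrow> complex^2^2 \<Rightarrow> (riemann_sphere \<Rightarrow> riemann_sphere) \<Rightarrow> bool" where
  "induces_reversing Half_Plane A f \<longleftrightarrow>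
     A \<in> GL2_real \<and> Re (det A) < 0 \<and> f = moebius A \<circ> map_option cnj"
| "induces_reversing Disk A f \<longleftrightarrow> A \<in> pos_SU11 \<and> f = moebius A \<circ> map_option cnj"


section \<open>The linear model\<close>

definition lorentz :: "real^3 \<Rightarrow> real^3 \<Rightarrow> real" where
  "lorentz u v = u$1 * v$1 - u$2 * v$2 - u$3 * v$3"

definition Q :: "real^3 \<Rightarrow> real" where
  "Q v = lorentz v v"

definition hyperboloid :: "(real^3) set" where
  "hyperboloid = {v. Q v = 1 \<and> v$1 > 0}"

definition linear_isometry :: "real^3^3 \<Rightarrow> bool" where
  "linear_isometry T \<longleftrightarrow> (\<forall>v. Q (T *v v) = Q v) \<and> (\<lambda>v. T *v v) ` hyperboloid = hyperboloid"

definition charpoly :: "real^3^3 \<Rightarrow> real poly" where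
  "charpoly T = det (mat [:0, 1:] - (\<chi> i j. [:T$i$j:]))"

definition is_elliptic :: "real^3^3 \<Rightarrow> bool" where
  "is_elliptic T \<longleftrightarrow> (\<exists>v \<mu>. Q v > 0 \<and> T *v v = \<mu> *\<^sub>R v)"

definition real_eigenvalue :: "real^3^3 \<Rightarrow> real \<Rightarrow> bool" where
  "real_eigenvalue T x \<longleftrightarrow> (\<exists>v. v \<noteq> 0 \<and> T *v v = x *\<^sub>R v)"

text \<open>\<^term>\<open>rotation_data p k m\<close>: the polynomial \<^term>\<open>p\<close> is
  $(x-1)^l (x+1)^m \prod_j (x^2 - 2 a_j x + 1)^{r_j}$ for some $l$, and $k = \sum_j r_j + [m/2]$.\<close>

definition rotation_data :: "real poly \<Rightarrow> nat \<Rightarrow> nat \<Rightarrow> bool" where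
  "rotation_data p k m \<longleftrightarrow>
     (\<exists>l s (a :: nat \<Rightarrow> real) (r :: nat \<Rightarrow> nat).
        inj_on a {1..s} \<and> (\<forall>j\<in>{1..s}. \<bar>a j\<bar> < 1) \<and>
        p = [:-1, 1:]^l * [:1, 1:]^m * (\<Prod>j=1..s. [:1, - 2 * a j, 1:]^(r j)) \<and>
        k = (\<Sum>j=1..s. r j) + m div 2)"

definition rotatory_elliptic :: "nat \<Rightarrow> real^3^3 \<Rightarrow> bool" where
  "rotatory_elliptic k T \<longleftrightarrow>
     is_elliptic T \<and> (\<exists>m. even m \<and> rotation_data (charpoly T) k m)"

definition rotatory_elliptic_inversion :: "nat \<Rightarrow> real^3^3 \<Rightarrow> bool" where
  "rotatory_elliptic_inversion k T \<longleftrightarrow>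
     is_elliptic T \<and> (\<exists>m. odd m \<and> rotation_data (charpoly T) k m)"

definition rotatory_hyperbolic_inversion :: "nat \<Rightarrow> real^3^3 \<Rightarrow> bool" where
  "rotatory_hyperbolic_inversion k T \<longleftrightarrow>
     (\<exists>x m p. x \<noteq> 1 \<and> x \<noteq> -1 \<and> real_eigenvalue T x \<and> odd m \<and> rotation_data p k m \<and>
        charpoly T = [:-x, 1:] * [:- inverse x, 1:] * p)"


section \<open>Identification of the models\<close>

fun to_hyperboloid :: "model \<Rightarrow> complex \<Rightarrow> real^3" where
  "to_hyperboloid Half_Plane z =
     (1 / (2 * Im z)) *\<^sub>R vector [(cmod z)^2 + 1, 2 * Re z, (cmod z)^2 - 1]"
| "to_hyperboloid Disk z =
     (1 / (1 - (cmod z)^2)) *\<^sub>R vector [1 + (cmod z)^2, 2 * Re z, 2 * Im z]"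

definition identified :: "model \<Rightarrow> (riemann_sphere \<Rightarrow> riemann_sphere) \<Rightarrow> real^3^3 \<Rightarrow> bool" where
  "identified X f T \<longleftrightarrow> linear_isometry T \<and>
     (\<forall>z\<in>points X. \<exists>w\<in>points X. f (Some z) = Some w \<and> T *v to_hyperboloid X z = to_hyperboloid X w)"

text \<open>The hyperboloid spans the space, so at most one \<^term>\<open>T\<close> is identified with a given map.
  The following lemmas show that \<^const>\<open>to_hyperboloid\<close> is the usual isometry onto the hyperboloid:
  it is a bijection, and the hyperbolic cosine of the distance of two points (in the standard
  metric of curvature $-1$ of either model) becomes \<^const>\<open>lorentz\<close>.\<close>

lemma lorentz_to_hyperboloid_Half_Plane:
  assumes "z \<in> points Half_Plane" "w \<in> points Half_Plane"
  shows "lorentz (to_hyperboloid Half_Plane z) (to_hyperboloid Half_Plane w) = 1 + (cmod (z - w))^2 / (2 * Im z * Im w)"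
  using assms
  by (simp add: lorentz_def cmod_power2 field_simps)
     (simp add: power2_eq_square algebra_simps)

lemma lorentz_to_hyperboloid_Disk:
  assumes "z \<in> points Disk" "w \<in> points Disk"
  shows "lorentz (to_hyperboloid Disk z) (to_hyperboloid Disk w) =
           1 + 2 * (cmod (z - w))^2 / ((1 - (cmod z)^2) * (1 - (cmod w)^2))"
proof -
  have "(cmod z)^2 < 1" "(cmod w)^2 < 1"
    using assms by (auto simp: abs_square_less_1)
  then have *: "1 - (cmod z)^2 \<noteq> 0" "1 - (cmod w)^2 \<noteq> 0" by auto
  have "lorentz (to_hyperboloid Disk z) (to_hyperboloid Disk w) =
      ((1 + (cmod z)^2) * (1 + (cmod w)^2) - 4 * (Re z * Re w + Im z * Im w))
        / ((1 - (cmod z)^2) * (1 - (cmod w)^2))"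
    by (simp add: lorentz_def diff_divide_distrib add_divide_distrib algebra_simps)
  also have "(1 + (cmod z)^2) * (1 + (cmod w)^2) - 4 * (Re z * Re w + Im z * Im w) =
      (1 - (cmod z)^2) * (1 - (cmod w)^2) + 2 * (cmod (z - w))^2"
    unfolding cmod_power2 by (simp add: power2_eq_square algebra_simps)
  finally show ?thesis using * by (simp add: add_divide_distrib)
qed

lemma bij_betw_to_hyperboloid: "bij_betw (to_hyperboloid X) (points X) hyperboloid"
proof (cases X)
  case Half_Plane
  have "bij_betw (to_hyperboloid Half_Plane) (points Half_Plane) hyperboloid"
  proof (rule bij_betw_byWitness[where f' = "\<lambda>v. Complex (v$2 / (v$1 - v$3)) (1 / (v$1 - v$3))"])
    have pos: "v$1 - v$3 > 0" if "v \<in> hyperboloid" for v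
    proof -
      have "v$3 * v$3 < v$1 * v$1" "v$1 > 0"
        using that zero_le_square[of "v$2"]
        unfolding hyperboloid_def Q_def lorentz_def mem_Collect_eq by linarith+
      then have "\<bar>v$3\<bar> < \<bar>v$1\<bar>"
        by (intro power2_less_imp_less[of "\<bar>v$3\<bar>"]) (simp_all add: power2_eq_square)
      then show ?thesis using \<open>v$1 > 0\<close> by linarith
    qed
    show "\<forall>z\<in>points Half_Plane. Complex (to_hyperboloid Half_Plane z$2 / (to_hyperboloid Half_Plane z$1 - to_hyperboloid Half_Plane z$3))
        (1 / (to_hyperboloid Half_Plane z$1 - to_hyperboloid Half_Plane z$3)) = z"
      by (auto simp: complex_eq_iff field_simps)
    show "to_hyperboloid Half_Plane ` points Half_Plane \<subseteq> hyperboloid"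
      using lorentz_to_hyperboloid_Half_Plane by (fastforce simp: hyperboloid_def Q_def add_nonneg_pos)
    show "(\<lambda>v. Complex (v$2 / (v$1 - v$3)) (1 / (v$1 - v$3))) ` hyperboloid \<subseteq> points Half_Plane"
      using pos by auto
    show "\<forall>v\<in>hyperboloid. to_hyperboloid Half_Plane (Complex (v$2 / (v$1 - v$3)) (1 / (v$1 - v$3))) = v"
    proof
      fix v assume v: "v \<in> hyperboloid"
      define d where "d = v$1 - v$3"
      have d: "d > 0" using pos[OF v] by (simp add: d_def)
      have q: "(v$2)^2 = d * (v$1 + v$3) - 1"
        using v by (simp add: hyperboloid_def Q_def lorentz_def d_def power2_eq_square algebra_simps)
      have n: "(cmod (Complex (v$2 / d) (1 / d)))^2 = (v$1 + v$3) / d"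
      proof -
        have "(cmod (Complex (v$2 / d) (1 / d)))^2 = (d * (v$1 + v$3)) / d^2"
          by (simp add: cmod_power2 power_divide q flip: add_divide_distrib)
        then show ?thesis using d by (simp add: power2_eq_square)
      qed
      show "to_hyperboloid Half_Plane (Complex (v$2 / (v$1 - v$3)) (1 / (v$1 - v$3))) = v"
        unfolding d_def[symmetric] to_hyperboloid.simps n using d
        by (simp add: vec_eq_iff forall_3 field_simps) (simp add: d_def algebra_simps)
    qed
  qed
  then show ?thesis using Half_Plane by simp
next
  case Disk
  have sq: "(cmod z)^2 < 1" if "z \<in> points Disk" for z
    using that by (auto simp: abs_square_less_1)
  have "bij_betw (to_hyperboloid Disk) (points Disk) hyperboloid"
  proof (rule bij_betw_byWitness[where f' = "\<lambda>v. Complex (v$2 / (1 + v$1)) (v$3 / (1 + v$1))"])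
    show "\<forall>z\<in>points Disk. Complex (to_hyperboloid Disk z$2 / (1 + to_hyperboloid Disk z$1))
        (to_hyperboloid Disk z$3 / (1 + to_hyperboloid Disk z$1)) = z"
    proof
      fix z assume "z \<in> points Disk"
      note s = sq[OF this]
      define r where "r = (cmod z)^2"
      have "1 - r \<noteq> 0" using s by (simp add: r_def)
      then have "1 + (1 + r) / (1 - r) = 2 / (1 - r)" by (simp add: field_simps)
      then show "Complex (to_hyperboloid Disk z$2 / (1 + to_hyperboloid Disk z$1))
        (to_hyperboloid Disk z$3 / (1 + to_hyperboloid Disk z$1)) = z"
        using \<open>1 - r \<noteq> 0\<close> by (simp add: complex_eq_iff flip: r_def)
    qed
    show "to_hyperboloid Disk ` points Disk \<subseteq> hyperboloid"
      using lorentz_to_hyperboloid_Disk sq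
      by (fastforce simp: hyperboloid_def Q_def add_pos_nonneg)
    have n: "(cmod (Complex (v$2 / (1 + v$1)) (v$3 / (1 + v$1))))^2 = (v$1 - 1) / (v$1 + 1)"
      and p: "v$1 > 0" if "v \<in> hyperboloid" for v
    proof -
      show p: "v$1 > 0" using that by (simp add: hyperboloid_def)
      have "(v$2)^2 + (v$3)^2 = (v$1 - 1) * (v$1 + 1)"
        using that by (simp add: hyperboloid_def Q_def lorentz_def power2_eq_square algebra_simps)
      then have "(cmod (Complex (v$2 / (1 + v$1)) (v$3 / (1 + v$1))))^2
          = (v$1 - 1) * (v$1 + 1) / (1 + v$1)^2"
        by (simp add: cmod_power2 power_divide flip: add_divide_distrib)
      then show "(cmod (Complex (v$2 / (1 + v$1)) (v$3 / (1 + v$1))))^2 = (v$1 - 1) / (v$1 + 1)"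
        using p by (simp add: power2_eq_square add.commute)
    qed
    show "(\<lambda>v. Complex (v$2 / (1 + v$1)) (v$3 / (1 + v$1))) ` hyperboloid \<subseteq> points Disk"
    proof clarify
      fix v assume v: "v \<in> hyperboloid"
      have "(cmod (Complex (v$2 / (1 + v$1)) (v$3 / (1 + v$1))))^2 < 1"
        unfolding n[OF v] using p[OF v] by simp
      then show "Complex (v$2 / (1 + v$1)) (v$3 / (1 + v$1)) \<in> points Disk"
        by (simp add: abs_square_less_1)
    qed
    show "\<forall>v\<in>hyperboloid. to_hyperboloid Disk (Complex (v$2 / (1 + v$1)) (v$3 / (1 + v$1))) = v"
    proof
      fix v assume v: "v \<in> hyperboloid"
      have e: "1 - (v$1 - 1) / (v$1 + 1) = 2 / (v$1 + 1)" "1 + (v$1 - 1) / (v$1 + 1) = 2 * v$1 / (v$1 + 1)"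
        using p[OF v] by (simp_all add: field_simps)
      show "to_hyperboloid Disk (Complex (v$2 / (1 + v$1)) (v$3 / (1 + v$1))) = v"
        unfolding to_hyperboloid.simps n[OF v] e using p[OF v]
        by (simp add: vec_eq_iff forall_3 add.commute)
    qed
  qed
  then show ?thesis using Disk by simp
qed

definition is_rotatory_elliptic ::
    "model \<Rightarrow> nat \<Rightarrow> (riemann_sphere \<Rightarrow> riemann_sphere) \<Rightarrow> bool" where
  "is_rotatory_elliptic X k f \<longleftrightarrow> (\<exists>T. identified X f T \<and> rotatory_elliptic k T)"

definition is_rotatory_elliptic_inversion ::
    "model \<Rightarrow> nat \<Rightarrow> (riemann_sphere \<Rightarrow> riemann_sphere) \<Rightarrow> bool" where
  "is_rotatory_elliptic_inversion X k f \<longleftrightarrow>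
     (\<exists>T. identified X f T \<and> rotatory_elliptic_inversion k T)"

definition is_rotatory_hyperbolic_inversion ::
    "model \<Rightarrow> nat \<Rightarrow> (riemann_sphere \<Rightarrow> riemann_sphere) \<Rightarrow> bool" where
  "is_rotatory_hyperbolic_inversion X k f \<longleftrightarrow>
     (\<exists>T. identified X f T \<and> rotatory_hyperbolic_inversion k T)"


section \<open>Half-turns\<close>

text \<open>If \<^term>\<open>c_inv A = 0\<close>, then \<^term>\<open>A\<close> is not scalar and
  \<^term>\<open>cmod (c_inv A - 2) = 2\<close>, but the induced map is a rotation by the angle $\pi$ and not a
  translation. The map $z \mapsto -1/z$ of the upper half-plane is an example.\<close>

lemma half_turn_not_translation:
  fixes A :: "complex^2^2"
  defines "A \<equiv> vector [vector [0, -1], vector [1, 0]]"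
  shows "induces_preserving Half_Plane A (moebius A)"
    and "cmod (c_inv A - 2) = 2"
    and "\<not> is_scalar A"
    and "\<not> is_translation (moebius A)"
proof -
  show "induces_preserving Half_Plane A (moebius A)"
    by (simp add: A_def GL2_real_def det_2 forall_2)
  show "cmod (c_inv A - 2) = 2"
    by (simp add: A_def c_inv_def det_2 trace_def sum_2)
  show "\<not> is_scalar A"
    by (auto simp: A_def is_scalar_def mat_def vec_eq_iff forall_2)
  show "\<not> is_translation (moebius A)"
  proof
    assume "is_translation (moebius A)"
    then obtain \<beta> M where b: "\<beta> \<noteq> 0" and M: "det M \<noteq> 0"
      and eq: "moebius M \<circ> moebius A = map_option (\<lambda>w. w + \<beta>) \<circ> moebius M"
      unfolding is_translation_def moebius_conjugate_def by blast
    have inv: "moebius A (moebius A x) = x" for x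
      by (cases x) (auto simp: A_def)
    have two: "map_option (\<lambda>w. w + \<beta>) (map_option (\<lambda>w. w + \<beta>) (moebius M x)) = moebius M x" for x
      using fun_cong[OF eq, of x] fun_cong[OF eq, of "moebius A x"] by (simp add: inv)
    have "moebius M x = None" for x
    proof (cases "moebius M x")
      case (Some y)
      have "y + \<beta> + \<beta> = y" using two[of x] unfolding Some by simp
      moreover have "y + \<beta> + \<beta> = y + 2 * \<beta>" by simp
      ultimately have "2 * \<beta> = 0" by (metis add_cancel_right_right)
      with b show ?thesis by simp
    qed
    from this[of None] this[of "Some 0"] have "M$2$1 = 0" "M$2$2 = 0"
      by (auto split: if_splits)
    with M show False by (simp add: det_2)
  qed
qed

end

(* Both models are reduced to a real matrix R with rows p, q and r, s: for the half-plane R = A, for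
   the disk R is the Cayley conjugate of A, with the columns exchanged in the reversing case. R acts
   on the hyperboloid by the adjoint representation, rescaled by 1/|det R|, whose characteristic
   polynomial is (x - e) (x^2 - ((p+s)^2/|det R| - 2e) x + 1) with e = sgn (det R); every rotatory
   type is read off from it. Stretches and translations come from the normal form of A as a complex
   2x2 matrix. For reversing maps c(B) = ((p+s)^2/det R - 2)^2 >= 4 with equality iff p + s = 0, so
   the case |c(B) - 2| < 2 does not occur. *)

theory Submission
  imports Defs
begin

section \<open>Normal forms of Moebius maps\<close>

text \<open>A vector of \<open>real^3\<close> encodes a symmetric 2x2 matrix S with \<open>Q\<close>
  equal to 4 det S, points of the hyperboloid being the positive definite S of determinant 1/4. The
  adjoint action is S -> R S R^T / |det R|; dividing by the modulus keeps S positive definite, hence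
  on the same sheet, also when R reverses orientation. If R has eigenvalues \<alpha> and \<mu>, the
  action has eigenvalues \<alpha>^2, \<alpha> \<mu> and \<mu>^2 divided by |\<alpha> \<mu>|, which
  explains the characteristic polynomial. The polynomial does not show the sign of \<open>Q\<close>
  on an eigenvector, so the elliptic cases also need an explicit positive vector: for a rotation the
  quadratic form vanishing at the fixed points; for a reflection that form is negative, and a point
  plus its mirror image is used instead. The half-turn, c = 0, is a boundary case of the rotations:
  its double eigenvalue -1 is counted through the exponent of x + 1, since a quadratic factor
  requires |a_j| < 1.\<close>

definition mat2 :: "'a::zero \<Rightarrow> 'a \<Rightarrow> 'a \<Rightarrow> 'a \<Rightarrow> 'a^2^2" where
  "mat2 a b c d = vector [vector [a, b], vector [c, d]]"

lemma mat2_nth [simp]: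
  "mat2 a b c d $ 1 $ 1 = a" "mat2 a b c d $ 1 $ 2 = b"
  "mat2 a b c d $ 2 $ 1 = c" "mat2 a b c d $ 2 $ 2 = d"
  by (simp_all add: mat2_def)

lemma mat2_eta: "mat2 (A$1$1) (A$1$2) (A$2$1) (A$2$2) = A"
  by (simp add: vec_eq_iff forall_2)

lemma det_mat2: "det (mat2 a b c d) = a * d - b * c"
  by (simp add: det_2)

lemma trace_mat2: "trace (mat2 a b c d) = a + d"
  by (simp add: trace_def sum_2)

lemma mat2_mult: "mat2 a b c d ** mat2 a' b' c' d' =
    mat2 (a * a' + b * c') (a * b' + b * d') (c * a' + d * c') (c * b' + d * d')"
  by (simp add: vec_eq_iff forall_2 matrix_matrix_mult_def sum_2)

lemma matrix_cnj_mat2: "matrix_cnj (mat2 a b c d) = mat2 (cnj a) (cnj b) (cnj c) (cnj d)"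
  by (simp add: vec_eq_iff forall_2 matrix_cnj_def)

lemma is_scalar_mat2: "is_scalar (mat2 a b c d) \<longleftrightarrow> a = d \<and> b = 0 \<and> c = 0"
  by (auto simp: is_scalar_def mat_def vec_eq_iff forall_2)

lemma c_inv_mat2: "c_inv (mat2 a b c d) = (a + d)^2 / (a * d - b * c)"
  by (simp add: c_inv_def det_mat2 trace_mat2)

text \<open>Homogeneous coordinates: on them \<open>moebius\<close> acts linearly, so poles and
  infinity need no separate treatment. The pair (0, 0) would also give \<open>None\<close>; it is
  excluded wherever the coordinates are used.\<close>

definition proj_point :: "complex \<Rightarrow> complex \<Rightarrow> riemann_sphere" where
  "proj_point n m = (if m = 0 then None else Some (n / m))"

lemma proj_point_surj:
  obtains n m where "x = proj_point n m" "n \<noteq> 0 \<or> m \<noteq> 0"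
proof (cases x)
  case None
  then show ?thesis using that[of 1 0] by (simp add: proj_point_def)
next
  case (Some z)
  then show ?thesis using that[of z 1] by (simp add: proj_point_def)
qed

lemma moebius_proj_point:
  assumes "n \<noteq> 0 \<or> m \<noteq> 0"
  shows "moebius M (proj_point n m) = proj_point (M$1$1 * n + M$1$2 * m) (M$2$1 * n + M$2$2 * m)"
proof (cases "m = 0")
  case True
  then show ?thesis using assms by (simp add: proj_point_def)
next
  case False
  have "M$i$1 * (n / m) + M$i$2 = (M$i$1 * n + M$i$2 * m) / m" for i
    using False by (simp add: add_divide_distrib)
  then show ?thesis using False by (simp add: proj_point_def)
qed

lemma moebius_mult:
  assumes "det N \<noteq> 0"
  shows "moebius (M ** N) = moebius M \<circ> moebius N"
proof
  fix x
  obtain n m where x: "x = proj_point n m" and nm: "n \<noteq> 0 \<or> m \<noteq> 0"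
    by (rule proj_point_surj)
  define n' m' where "n' = N$1$1 * n + N$1$2 * m" and "m' = N$2$1 * n + N$2$2 * m"
  \<comment> \<open>Cramer's rule: the adjugate of \<open>N\<close> recovers the pair, so an
    invertible \<open>N\<close> cannot send it to (0, 0).\<close>
  have "det N * n = N$2$2 * n' - N$1$2 * m'" "det N * m = N$1$1 * m' - N$2$1 * n'"
    by (simp_all add: det_2 n'_def m'_def algebra_simps)
  then have "n' \<noteq> 0 \<or> m' \<noteq> 0" using assms nm by fastforce
  moreover have "(M ** N)$i$1 * n + (M ** N)$i$2 * m = M$i$1 * n' + M$i$2 * m'" for i
    by (simp add: matrix_matrix_mult_def sum_2 n'_def m'_def algebra_simps)
  ultimately show "moebius (M ** N) x = (moebius M \<circ> moebius N) x"
    using nm by (simp add: x moebius_proj_point flip: n'_def m'_def)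
qed

lemma moebius_mat2_scale:
  assumes "t \<noteq> 0"
  shows "moebius (mat2 (t * a) (t * b) (t * c) (t * d)) = moebius (mat2 a b c d)"
proof
  fix x
  have "t * c * z + t * d = t * (c * z + d)" "t * a * z + t * b = t * (a * z + b)" for z
    by (simp_all add: algebra_simps)
  then show "moebius (mat2 (t * a) (t * b) (t * c) (t * d)) x = moebius (mat2 a b c d) x"
    using assms by (cases x) simp_all
qed

section \<open>Diagonal and Jordan forms\<close>

lemma moebius_upper_triangular:
  assumes "d \<noteq> 0"
  shows "moebius (mat2 a b 0 d) = map_option (\<lambda>w. (a * w + b) / d)"
proof
  fix x show "moebius (mat2 a b 0 d) x = map_option (\<lambda>w. (a * w + b) / d) x"
    using assms by (cases x) auto
qed

lemma moebius_conjugateI: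
  assumes "det A \<noteq> 0" "det M \<noteq> 0" "M ** A = D ** M"
  shows "moebius_conjugate (moebius A) (moebius D)"
  unfolding moebius_conjugate_def using assms moebius_mult by metis

text \<open>The equation \<open>M ** A = D ** M\<close> says that the rows of \<open>M\<close> are
  left eigenvectors of \<open>A\<close>, for \<alpha> and \<mu> in this order. The rows
  \<open>c, \<alpha> - a\<close> and \<open>c, \<mu> - a\<close> are independent unless
  \<open>c = 0\<close>; a triangular \<open>A\<close> gets its own pair, according to which
  eigenvalue stands first on the diagonal.\<close>

lemma moebius_conjugate_diagonal:
  assumes d: "det A \<noteq> 0" and t: "trace A = \<alpha> + \<mu>" and p: "det A = \<alpha> * \<mu>" and ne: "\<alpha> \<noteq> \<mu>"
  shows "moebius_conjugate (moebius A) (moebius (mat2 \<alpha> 0 0 \<mu>))"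
proof -
  obtain a b c e where A: "A = mat2 a b c e" using mat2_eta by metis
  have t': "a + e = \<alpha> + \<mu>" and p': "a * e - b * c = \<alpha> * \<mu>"
    using t p by (simp_all add: A trace_mat2 det_mat2)
  have e: "e = \<alpha> + \<mu> - a" using t' by (metis add_diff_cancel_left')
  \<comment> \<open>The characteristic polynomial evaluated at \<open>a\<close>; hence
    \<open>c = 0\<close> forces \<open>a\<close> to be an eigenvalue.\<close>
  have q: "b * c = (\<alpha> - a) * (a - \<mu>)" using p' unfolding e by (simp add: algebra_simps)
  consider "c \<noteq> 0" | "c = 0" "a = \<alpha>" | "c = 0" "a = \<mu>"
    using q by (cases "c = 0") auto
  then obtain M where "det M \<noteq> 0" "M ** A = mat2 \<alpha> 0 0 \<mu> ** M"
  proof cases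
    case 1
    show ?thesis
    proof (rule that[of "mat2 c (\<alpha> - a) c (\<mu> - a)"])
      show "det (mat2 c (\<alpha> - a) c (\<mu> - a)) \<noteq> 0"
        using 1 ne by (simp add: det_mat2 algebra_simps)
      have "c * b + (\<alpha> - a) * e = \<alpha> * (\<alpha> - a)" "c * b + (\<mu> - a) * e = \<mu> * (\<mu> - a)"
        "c * a + (\<alpha> - a) * c = \<alpha> * c" "c * a + (\<mu> - a) * c = \<mu> * c"
        using q unfolding e by algebra+
      then show "mat2 c (\<alpha> - a) c (\<mu> - a) ** A = mat2 \<alpha> 0 0 \<mu> ** mat2 c (\<alpha> - a) c (\<mu> - a)"
        unfolding A mat2_mult by simp
    qed
  next
    case 2
    show ?thesis
    proof (rule that[of "mat2 (\<alpha> - \<mu>) b 0 1"])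
      show "det (mat2 (\<alpha> - \<mu>) b 0 1) \<noteq> 0" using ne by (simp add: det_mat2)
      show "mat2 (\<alpha> - \<mu>) b 0 1 ** A = mat2 \<alpha> 0 0 \<mu> ** mat2 (\<alpha> - \<mu>) b 0 1"
        unfolding A mat2_mult by (simp add: e 2 algebra_simps)
    qed
  next
    case 3
    show ?thesis
    proof (rule that[of "mat2 0 1 (\<mu> - \<alpha>) b"])
      show "det (mat2 0 1 (\<mu> - \<alpha>) b) \<noteq> 0" using ne by (simp add: det_mat2)
      show "mat2 0 1 (\<mu> - \<alpha>) b ** A = mat2 \<alpha> 0 0 \<mu> ** mat2 0 1 (\<mu> - \<alpha>) b"
        unfolding A mat2_mult by (simp add: e 3 algebra_simps)
    qed
  qed
  then show ?thesis using d moebius_conjugateI by blast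
qed

text \<open>The larger root of k^2 - s k + 1. It supplies both the factor of a stretch and the real
  eigenvalue of a glide reflection.\<close>

lemma sum_with_inverse_surj:
  fixes s :: real
  assumes "s > 2"
  obtains k where "k > 1" "k + inverse k = s"
proof -
  define w where "w = sqrt (s^2 - 4)"
  have "s * s > 2 * 2" using assms by (intro mult_strict_mono) auto
  then have w: "w > 0" "w * w = s * s - 4" by (simp_all add: w_def power2_eq_square)
  define k where "k = (s + w) / 2"
  have k: "k > 1" using assms w by (simp add: k_def)
  have "k * k + 1 = s * k" using w by (simp add: k_def field_simps)
  moreover have "k + inverse k = (k * k + 1) / k" using k by (simp add: add_divide_distrib inverse_eq_divide)
  ultimately have "k + inverse k = s" using k by simp
  with k show ?thesis by (rule that)
qed

text \<open>Eigenvalues in ratio k give c = (1 + k)^2 / k = k + 1/k + 2, so k is found from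
  \<open>x - 2 > 2\<close>; the trace then fixes the smaller eigenvalue as
  \<open>trace A / (1 + k)\<close>.\<close>

lemma is_stretch_moebius:
  assumes d: "det A \<noteq> 0" and c: "c_inv A = of_real x" and x: "x > 4"
  shows "is_stretch (moebius A)"
proof -
  obtain k where k: "k > 1" "k + inverse k = x - 2"
    using sum_with_inverse_surj[of "x - 2"] x by auto
  have k1: "1 + of_real k \<noteq> (0::complex)"
    using k(1) of_real_eq_0_iff[of "1 + k", where 'a = complex] by simp
  have xk: "x * k = (1 + k)^2"
  proof -
    have "(x - 2) * k = k * k + 1" unfolding k(2)[symmetric] using k(1) by (simp add: distrib_right)
    then show ?thesis by (simp add: algebra_simps power2_eq_square)
  qed
  define \<mu> where "\<mu> = trace A / (1 + of_real k)"
  have t2: "(trace A)^2 = of_real x * det A"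
    using c d by (simp add: c_inv_def divide_eq_eq)
  then have "trace A \<noteq> 0" using d x by auto
  then have mu: "\<mu> \<noteq> 0" using k1 by (simp add: \<mu>_def)
  have "(of_real k * \<mu>) * \<mu> = of_real k * (trace A)^2 / (1 + of_real k)^2"
    by (simp add: \<mu>_def power2_eq_square)
  also have "\<dots> = of_real (x * k) * det A / (1 + of_real k)^2"
    by (simp add: t2 mult_ac)
  also have "\<dots> = det A" unfolding xk using k1 by simp
  finally have p: "det A = (of_real k * \<mu>) * \<mu>" ..
  have "of_real k * \<mu> + \<mu> = (1 + of_real k) * \<mu>" by (simp add: algebra_simps)
  also have "\<dots> = trace A" using k1 by (simp add: \<mu>_def)
  finally have t: "trace A = of_real k * \<mu> + \<mu>" ..
  have "of_real k \<noteq> (1::complex)" using k(1) by simp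
  then have "of_real k * \<mu> \<noteq> \<mu>" using mu by simp
  from moebius_conjugate_diagonal[OF d t p this]
  have "moebius_conjugate (moebius A) (map_option (\<lambda>w. of_real k * w))"
    using mu by (simp add: moebius_upper_triangular)
  moreover have "k > 0" "k \<noteq> 1" using k by simp_all
  ultimately show ?thesis unfolding is_stretch_def by blast
qed

text \<open>c = 4 means that the discriminant vanishes, so half the trace is a double eigenvalue
  \<alpha>. For a non-scalar matrix the Jordan block has an off-diagonal entry \<nu> different from
  0 and acts as the translation by \<nu> / \<alpha>.\<close>

lemma is_translation_moebius:
  assumes d: "det A \<noteq> 0" and c: "c_inv A = 4" and ns: "\<not> is_scalar A"
  shows "is_translation (moebius A)"
proof -
  obtain a b c e where A: "A = mat2 a b c e" using mat2_eta by metis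
  define \<alpha> where "\<alpha> = (a + e) / 2"
  have "2 * \<alpha> = a + e" by (simp add: \<alpha>_def)
  then have e: "e = 2 * \<alpha> - a" by simp
  have q0: "(a + e)^2 = 4 * (a * e - b * c)"
    using c d by (simp add: A c_inv_mat2 det_mat2 divide_eq_eq)
  have q: "b * c = - ((\<alpha> - a)^2)"
    using q0 unfolding e by algebra
  have "det A = \<alpha>^2"
    using q unfolding A det_mat2 e by algebra
  then have l: "\<alpha> \<noteq> 0" using d by auto
  obtain M \<nu> where "\<nu> \<noteq> 0" "det M \<noteq> 0" "M ** A = mat2 \<alpha> \<nu> 0 \<alpha> ** M"
  proof (cases "c = 0")
    case False
    \<comment> \<open>A Jordan chain of rows: (0, 1) A - \<alpha> (0, 1) is the left eigenvector (c,
      \<alpha> - a).\<close>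
    show ?thesis
    proof (rule that[of 1 "mat2 0 1 c (\<alpha> - a)"])
      show "det (mat2 0 1 c (\<alpha> - a)) \<noteq> 0" using False by (simp add: det_mat2)
      have "c * b + (\<alpha> - a) * e = \<alpha> * (\<alpha> - a)" using q unfolding e by algebra
      moreover have "c * a + (\<alpha> - a) * c = \<alpha> * c" by (simp add: algebra_simps)
      ultimately show "mat2 0 1 c (\<alpha> - a) ** A = mat2 \<alpha> 1 0 \<alpha> ** mat2 0 1 c (\<alpha> - a)"
        unfolding A mat2_mult by (simp add: e)
    qed simp
  next
    case True
    then have "a = \<alpha>" using q by simp
    moreover have "b \<noteq> 0" using ns True \<open>a = \<alpha>\<close> e by (auto simp: A is_scalar_mat2)
    ultimately show ?thesis
      using that[of b "mat2 1 0 0 1"] by (simp add: A mat2_mult True e det_mat2)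
  qed
  then have "moebius_conjugate (moebius A) (moebius (mat2 \<alpha> \<nu> 0 \<alpha>))"
    using d moebius_conjugateI by blast
  moreover have "moebius (mat2 \<alpha> \<nu> 0 \<alpha>) = map_option (\<lambda>w. w + \<nu> / \<alpha>)"
    using l by (simp add: moebius_upper_triangular add_divide_distrib)
  moreover have "\<nu> / \<alpha> \<noteq> 0" using l \<open>\<nu> \<noteq> 0\<close> by simp
  ultimately show ?thesis unfolding is_translation_def by metis
qed

lemma moebius_scalar:
  assumes "is_scalar A" "det A \<noteq> 0"
  shows "moebius A = id"
proof -
  obtain a where "A = mat2 a 0 0 a" using assms(1) mat2_eta[of A] is_scalar_mat2 by metis
  moreover from this have "a \<noteq> 0" using assms(2) by (auto simp: det_mat2)
  ultimately show ?thesis by (simp add: moebius_upper_triangular option.map_id0[unfolded id_def] id_def)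
qed

section \<open>Isometries of the linear model\<close>

lemma charpoly_conv:
  "charpoly T = [:- det T,
     T$1$1 * T$2$2 - T$1$2 * T$2$1 + (T$1$1 * T$3$3 - T$1$3 * T$3$1) + (T$2$2 * T$3$3 - T$2$3 * T$3$2),
     - trace T, 1:]"
  by (simp add: charpoly_def det_3 mat_def trace_def sum_3 algebra_simps)

lemma poly_charpoly: "poly (charpoly T) x = det (mat x - T)"
  by (simp add: charpoly_conv det_3 mat_def trace_def sum_3 algebra_simps)

lemma real_eigenvalue_iff: "real_eigenvalue T x \<longleftrightarrow> poly (charpoly T) x = 0"
proof -
  have "T *v v = x *\<^sub>R v \<longleftrightarrow> (mat x - T) *v v = 0" for v
  proof -
    have "mat x *v v = x *\<^sub>R v"
      by (simp add: vec_eq_iff forall_3 matrix_vector_mult_def mat_def sum_3)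
    then show ?thesis by (auto simp: matrix_vector_mult_diff_rdistrib)
  qed
  then show ?thesis
    unfolding real_eigenvalue_def poly_charpoly
    by (metis matrix_left_invertible_ker invertible_det_nz invertible_left_inverse)
qed

section \<open>From invariance of the form to identification with a map\<close>

lemma Q_add: "Q (v + w) = Q v + Q w + 2 * lorentz v w"
  by (simp add: Q_def lorentz_def algebra_simps)

lemma Q_minus: "Q (- v) = Q v"
  by (simp add: Q_def lorentz_def)

text \<open>Surjectivity on the sheet comes for free: polarization and nondegeneracy make
  \<open>T\<close> invertible, and a preimage on the opposite sheet is impossible because its
  negative lies on the sheet and would be sent to the negative of a point of the sheet.\<close>

lemma linear_isometryI:
  assumes Q: "\<And>v. Q (T *v v) = Q v"
    and H: "\<And>v. v \<in> hyperboloid \<Longrightarrow> T *v v \<in> hyperboloid"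
  shows "linear_isometry T"
proof -
  have pol: "lorentz (T *v v) (T *v w) = lorentz v w" for v w
    using Q[of "v + w"] by (simp add: Q_add Q matrix_vector_right_distrib)
  have inj: "v = 0" if "T *v v = 0" for v
  proof -
    have "lorentz v w = 0" for w
      using pol[of v w] that by (simp add: lorentz_def)
    from this[of "axis 1 1"] this[of "axis 2 1"] this[of "axis 3 1"]
    show ?thesis by (simp add: lorentz_def axis_def vec_eq_iff forall_3)
  qed
  obtain B where "B ** T = mat 1"
    using inj matrix_left_invertible_ker by blast
  then have "T ** B = mat 1" by (simp add: matrix_left_right_inverse)
  then have B: "T *v (B *v v) = v" for v by (simp add: matrix_vector_mul_assoc)
  have "hyperboloid \<subseteq> (*v) T ` hyperboloid"
  proof
    fix v assume v: "v \<in> hyperboloid"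
    define u where "u = B *v v"
    have u: "v = T *v u" by (simp add: u_def B)
    have Qu: "Q u = 1" using v Q u by (simp add: hyperboloid_def)
    have "u$1 > 0"
    proof (rule ccontr)
      assume "\<not> u$1 > 0"
      moreover have "u$1 \<noteq> 0"
      proof
        assume "u$1 = 0"
        then have "1 + u$2 * u$2 + u$3 * u$3 = 0" using Qu by (simp add: Q_def lorentz_def)
        then show False using zero_le_square[of "u$2"] zero_le_square[of "u$3"] by linarith
      qed
      ultimately have "- u \<in> hyperboloid" using Qu by (simp add: hyperboloid_def Q_minus)
      then have "- v \<in> hyperboloid" using H[of "- u"] u by (simp add: vec.neg)
      then show False using v by (simp add: hyperboloid_def)
    qed
    then show "v \<in> (*v) T ` hyperboloid" using u Qu by (simp add: hyperboloid_def)
  qed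
  then show ?thesis unfolding linear_isometry_def using Q H by blast
qed

lemma identifiedI:
  assumes Q: "\<And>v. Q (T *v v) = Q v"
    and p: "\<And>z. z \<in> points X \<Longrightarrow>
      \<exists>w\<in>points X. f (Some z) = Some w \<and> T *v to_hyperboloid X z = to_hyperboloid X w"
  shows "identified X f T"
proof -
  have "T *v v \<in> hyperboloid" if "v \<in> hyperboloid" for v
  proof -
    have h: "to_hyperboloid X ` points X = hyperboloid"
      using bij_betw_to_hyperboloid by (rule bij_betw_imp_surj_on)
    then obtain z where z: "z \<in> points X" "v = to_hyperboloid X z" using \<open>v \<in> hyperboloid\<close> by blast
    then obtain w where "w \<in> points X" "T *v v = to_hyperboloid X w" using p by blast
    then show ?thesis using h by blast
  qed
  with Q have "linear_isometry T" by (rule linear_isometryI)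
  with p show ?thesis by (simp add: identified_def)
qed

text \<open>For \<alpha> = -1 the quadratic is (x + 1)^2, which is not an admissible factor; it is
  recorded as \<open>m = 2\<close> with no quadratic factors, and \<open>2 div 2\<close> still gives
  one rotation.\<close>

lemma rotatory_elliptic_1I:
  assumes "is_elliptic T" "charpoly T = [:-1, 1:] * [:1, - 2 * \<alpha>, 1:]" "-1 \<le> \<alpha>" "\<alpha> < 1"
  shows "rotatory_elliptic 1 T"
proof (cases "\<alpha> = -1")
  case True
  have "charpoly T = [:-1, 1:]^1 * [:1, 1:]^2 * (\<Prod>j=1..0::nat. [:1, - 2 * (0::real), 1:]^0)"
    using assms(2) True by (simp add: power2_eq_square)
  then have "rotation_data (charpoly T) 1 2"
    unfolding rotation_data_def
    by (intro exI[of _ 1] exI[of _ 0] exI[of _ "\<lambda>_. 0"] exI[of _ "\<lambda>_. 0"]) auto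
  then show ?thesis using assms(1) unfolding rotatory_elliptic_def by (meson even_numeral)
next
  case False
  then have "rotation_data (charpoly T) 1 0"
    unfolding rotation_data_def using assms
    by (intro exI[of _ 1] exI[of _ 1] exI[of _ "\<lambda>_. \<alpha>"] exI[of _ "\<lambda>_. 1"]) auto
  then show ?thesis using assms(1) unfolding rotatory_elliptic_def by (meson even_zero)
qed

text \<open>The single factor x + 1 makes \<open>m = 1\<close>: odd, hence an inversion, while
  \<open>1 div 2 = 0\<close> contributes no rotation.\<close>

lemma rotatory_elliptic_inversion_0I:
  assumes "is_elliptic T" "charpoly T = [:-1, 1:]^2 * [:1, 1:]"
  shows "rotatory_elliptic_inversion 0 T"
proof -
  have "rotation_data (charpoly T) 0 1"
    unfolding rotation_data_def using assms(2)
    by (intro exI[of _ 2] exI[of _ 0] exI[of _ "\<lambda>_. 0"] exI[of _ "\<lambda>_. 0"]) auto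
  then show ?thesis using assms(1) unfolding rotatory_elliptic_inversion_def by (meson odd_one)
qed

lemma rotatory_hyperbolic_inversion_0I:
  assumes "charpoly T = [:-x, 1:] * [:- inverse x, 1:] * [:1, 1:]" "x > 1"
  shows "rotatory_hyperbolic_inversion 0 T"
proof -
  have "rotation_data [:1, 1:] 0 1"
    unfolding rotation_data_def
    by (intro exI[of _ 0] exI[of _ 0] exI[of _ "\<lambda>_. 0"] exI[of _ "\<lambda>_. 0"]) auto
  moreover have "real_eigenvalue T x" unfolding real_eigenvalue_iff assms(1) poly_mult by simp
  moreover have "x \<noteq> 1" "x \<noteq> -1" using assms(2) by auto
  ultimately show ?thesis using assms(1) unfolding rotatory_hyperbolic_inversion_def by (meson odd_one)
qed

text \<open>The image in $O(Q)$ of the real matrix with rows \<open>p, q\<close> and \<open>r, s\<close>. In the coordinates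
  \<open>n = (v$1 + v$3) / 2\<close>, \<open>y = v$2 / 2\<close>, \<open>m = (v$1 - v$3) / 2\<close> a point \<open>z\<close> of the half-plane has
  $(n, y, m)$ proportional to \<open>(cmod z ^ 2, Re z, 1)\<close>, and the matrix acts by
  $n' = p^2 n + 2pqy + q^2 m$, $y' = prn + (ps+qr)y + qsm$, $m' = r^2 n + 2rsy + s^2 m$. Substituting
  \<open>cnj z\<close> for \<open>z\<close> changes none of this, so the formula serves both orientations.\<close>

definition adj_rep :: "real \<Rightarrow> real \<Rightarrow> real \<Rightarrow> real \<Rightarrow> real^3^3" where
  "adj_rep p q r s = (1 / \<bar>p * s - q * r\<bar>) *\<^sub>R vector
     [vector [(p^2 + q^2 + r^2 + s^2) / 2, p * q + r * s, (p^2 - q^2 + r^2 - s^2) / 2],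
      vector [p * r + q * s, p * s + q * r, p * r - q * s],
      vector [(p^2 + q^2 - r^2 - s^2) / 2, p * q - r * s, (p^2 - q^2 - r^2 + s^2) / 2]]"

lemma adj_rep_nth:
  "adj_rep p q r s $ 1 $ 1 = (p^2 + q^2 + r^2 + s^2) / 2 / \<bar>p * s - q * r\<bar>"
  "adj_rep p q r s $ 1 $ 2 = (p * q + r * s) / \<bar>p * s - q * r\<bar>"
  "adj_rep p q r s $ 1 $ 3 = (p^2 - q^2 + r^2 - s^2) / 2 / \<bar>p * s - q * r\<bar>"
  "adj_rep p q r s $ 2 $ 1 = (p * r + q * s) / \<bar>p * s - q * r\<bar>"
  "adj_rep p q r s $ 2 $ 2 = (p * s + q * r) / \<bar>p * s - q * r\<bar>"
  "adj_rep p q r s $ 2 $ 3 = (p * r - q * s) / \<bar>p * s - q * r\<bar>"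
  "adj_rep p q r s $ 3 $ 1 = (p^2 + q^2 - r^2 - s^2) / 2 / \<bar>p * s - q * r\<bar>"
  "adj_rep p q r s $ 3 $ 2 = (p * q - r * s) / \<bar>p * s - q * r\<bar>"
  "adj_rep p q r s $ 3 $ 3 = (p^2 - q^2 - r^2 + s^2) / 2 / \<bar>p * s - q * r\<bar>"
  by (simp_all add: adj_rep_def)

lemma adj_rep_mult_vec:
  "(adj_rep p q r s *v v)$1 = ((p^2 + q^2 + r^2 + s^2) / 2 * v$1 + (p * q + r * s) * v$2
      + (p^2 - q^2 + r^2 - s^2) / 2 * v$3) / \<bar>p * s - q * r\<bar>"
  "(adj_rep p q r s *v v)$2 = ((p * r + q * s) * v$1 + (p * s + q * r) * v$2
      + (p * r - q * s) * v$3) / \<bar>p * s - q * r\<bar>"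
  "(adj_rep p q r s *v v)$3 = ((p^2 + q^2 - r^2 - s^2) / 2 * v$1 + (p * q - r * s) * v$2
      + (p^2 - q^2 - r^2 + s^2) / 2 * v$3) / \<bar>p * s - q * r\<bar>"
proof -
  have "a / d * x + b / d * y + c / d * z = (a * x + b * y + c * z) / d" for a b c d x y z :: real
    by (simp add: add_divide_distrib)
  then show "(adj_rep p q r s *v v)$1 = ((p^2 + q^2 + r^2 + s^2) / 2 * v$1 + (p * q + r * s) * v$2
      + (p^2 - q^2 + r^2 - s^2) / 2 * v$3) / \<bar>p * s - q * r\<bar>"
    "(adj_rep p q r s *v v)$2 = ((p * r + q * s) * v$1 + (p * s + q * r) * v$2
      + (p * r - q * s) * v$3) / \<bar>p * s - q * r\<bar>"
    "(adj_rep p q r s *v v)$3 = ((p^2 + q^2 - r^2 - s^2) / 2 * v$1 + (p * q - r * s) * v$2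
      + (p^2 - q^2 - r^2 + s^2) / 2 * v$3) / \<bar>p * s - q * r\<bar>"
    by (simp_all only: matrix_vector_mult_def sum_3 adj_rep_nth vec_lambda_beta)
qed

text \<open>\<open>Q v\<close> is four times the determinant of the symmetric matrix with entries
  \<open>n, y, m\<close>. The action S -> R S R^T multiplies it by the square of det R, which the
  factor \<open>1 / D\<close> of the representation cancels.\<close>

lemma Q_adj_rep:
  assumes "p * s - q * r \<noteq> 0"
  shows "Q (adj_rep p q r s *v v) = Q v"
proof -
  define D where "D = \<bar>p * s - q * r\<bar>"
  have D: "D \<noteq> 0" "D^2 = (p * s - q * r)^2" using assms by (auto simp: D_def)
  define n y m where "n = (v$1 + v$3) / 2" and "y = v$2 / 2" and "m = (v$1 - v$3) / 2"
  have v: "v$1 = n + m" "v$2 = 2 * y" "v$3 = n - m"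
    by (simp_all add: n_def y_def m_def field_simps)
  define n' y' m' where "n' = p^2 * n + 2 * p * q * y + q^2 * m"
    and "y' = p * r * n + (p * s + q * r) * y + q * s * m"
    and "m' = r^2 * n + 2 * r * s * y + s^2 * m"
  have "(p^2 + q^2 + r^2 + s^2) / 2 * (n + m) + (p * q + r * s) * (2 * y)
      + (p^2 - q^2 + r^2 - s^2) / 2 * (n - m) = n' + m'"
    "(p * r + q * s) * (n + m) + (p * s + q * r) * (2 * y) + (p * r - q * s) * (n - m) = 2 * y'"
    "(p^2 + q^2 - r^2 - s^2) / 2 * (n + m) + (p * q - r * s) * (2 * y)
      + (p^2 - q^2 - r^2 + s^2) / 2 * (n - m) = n' - m'"
    unfolding n'_def y'_def m'_def by (simp_all add: field_simps)
  then have w: "(adj_rep p q r s *v v)$1 = (n' + m') / D" "(adj_rep p q r s *v v)$2 = 2 * y' / D"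
    "(adj_rep p q r s *v v)$3 = (n' - m') / D"
    unfolding adj_rep_mult_vec D_def[symmetric] v by simp_all
  have "Q (adj_rep p q r s *v v) = 4 * (n' * m' - y'^2) / D^2"
    unfolding Q_def lorentz_def w using D(1) by (simp add: field_simps power2_eq_square)
  also have "n' * m' - y'^2 = D^2 * (n * m - y^2)"
    unfolding D(2) n'_def y'_def m'_def by algebra
  also have "4 * (D^2 * (n * m - y^2)) / D^2 = 4 * (n * m - y^2)"
    using D(1) by simp
  also have "\<dots> = Q v"
    by (simp add: Q_def lorentz_def v algebra_simps power2_eq_square)
  finally show ?thesis .
qed

text \<open>Apart from \<epsilon>, the eigenvalues are the squares of those of the 2x2 matrix
  divided by \<open>D\<close>: their product is 1 and their sum is ((p + s)^2 - 2 \<epsilon> D) / D.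
  The proof compares the three coefficients, with \<open>n11\<close> to \<open>n33\<close> as the
  numerators of the entries.\<close>

lemma charpoly_adj_rep:
  assumes d: "p * s - q * r = \<epsilon> * D" and \<epsilon>: "\<epsilon> = 1 \<or> \<epsilon> = -1" and D: "D > 0"
  shows "charpoly (adj_rep p q r s) = [:- \<epsilon>, 1:] * [:1, - ((p + s)^2 / D - 2 * \<epsilon>), 1:]"
proof -
  have ab: "\<bar>p * s - q * r\<bar> = D" using assms by (auto simp: abs_mult)
  have \<epsilon>2: "\<epsilon> * \<epsilon> = 1" using \<epsilon> by auto
  define n11 n12 n13 n21 n22 n23 n31 n32 n33 where
    n: "n11 = (p^2 + q^2 + r^2 + s^2) / 2" "n12 = p * q + r * s" "n13 = (p^2 - q^2 + r^2 - s^2) / 2"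
      "n21 = p * r + q * s" "n22 = p * s + q * r" "n23 = p * r - q * s"
      "n31 = (p^2 + q^2 - r^2 - s^2) / 2" "n32 = p * q - r * s" "n33 = (p^2 - q^2 - r^2 + s^2) / 2"
  note N = adj_rep_nth[of p q r s, unfolded ab, folded n]
  \<comment> \<open>Doubling removes the halves and leaves purely polynomial relations.\<close>
  have n2: "2 * n11 = p^2 + q^2 + r^2 + s^2" "2 * n13 = p^2 - q^2 + r^2 - s^2"
    "2 * n31 = p^2 + q^2 - r^2 - s^2" "2 * n33 = p^2 - q^2 - r^2 + s^2"
    by (simp_all add: n)
  note n' = n2 n(2,4,5,6,8)
  have tr: "n11 + n22 + n33 = (p + s)^2 - (p * s - q * r)"
    using n' by algebra
  have m: "n11 * n22 - n12 * n21 + (n11 * n33 - n13 * n31) + (n22 * n33 - n23 * n32)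
      = (p * s - q * r) * ((p + s)^2 - (p * s - q * r))"
    using n' by algebra
  have det: "n11 * n22 * n33 + n12 * n23 * n31 + n13 * n21 * n32 - n11 * n23 * n32
      - n12 * n21 * n33 - n13 * n22 * n31 = (p * s - q * r)^3"
    using n' by algebra
  have "trace (adj_rep p q r s) = (n11 + n22 + n33) / D"
    by (simp add: trace_def sum_3 N add_divide_distrib)
  also have "\<dots> = (p + s)^2 / D - \<epsilon>"
    unfolding tr d using D by (simp add: diff_divide_distrib)
  finally have T: "trace (adj_rep p q r s) = (p + s)^2 / D - \<epsilon>" .
  have "det (adj_rep p q r s) = (n11 * n22 * n33 + n12 * n23 * n31 + n13 * n21 * n32 - n11 * n23 * n32
      - n12 * n21 * n33 - n13 * n22 * n31) / D^3"
    by (simp add: det_3 N power3_eq_cube add_divide_distrib diff_divide_distrib)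
  also have "\<dots> = \<epsilon>"
    unfolding det d using D \<epsilon> by (auto simp: power_mult_distrib)
  finally have E: "det (adj_rep p q r s) = \<epsilon>" .
  let ?M = "\<lambda>T::real^3^3. T$1$1 * T$2$2 - T$1$2 * T$2$1 + (T$1$1 * T$3$3 - T$1$3 * T$3$1)
      + (T$2$2 * T$3$3 - T$2$3 * T$3$2)"
  have "?M (adj_rep p q r s) = (n11 * n22 - n12 * n21 + (n11 * n33 - n13 * n31) + (n22 * n33 - n23 * n32)) / D^2"
    by (simp add: N power2_eq_square add_divide_distrib diff_divide_distrib)
  also have "\<dots> = \<epsilon> * ((p + s)^2 / D - \<epsilon>)"
    unfolding m d using D by (simp add: field_simps power2_eq_square)
  finally show ?thesis
    unfolding charpoly_conv E T using \<epsilon>2 by (simp add: algebra_simps)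
qed

text \<open>The eigenvector is the quadratic polynomial \<open>r z\<^sup>2 + (s - p) z - q\<close> of the fixed points:
  a root \<open>z\<close> in the half-plane has \<open>cmod z ^ 2 = - q / r\<close> and \<open>2 Re z = (p - s) / r\<close>.\<close>

lemma adj_rep_eigenvector:
  assumes d: "p * s - q * r = \<epsilon> * D" and \<epsilon>: "\<epsilon> = 1 \<or> \<epsilon> = -1" and D: "D > 0"
  defines "v \<equiv> vector [r - q, p - s, - q - r] :: real^3"
  shows "adj_rep p q r s *v v = \<epsilon> *\<^sub>R v" and "Q v = 4 * (p * s - q * r) - (p + s)^2"
proof -
  have ab: "\<bar>p * s - q * r\<bar> = D" using assms by (auto simp: abs_mult)
  have v: "v$1 = r - q" "v$2 = p - s" "v$3 = - q - r" by (simp_all add: v_def)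
  have "((p^2 + q^2 + r^2 + s^2) / 2 * (r - q) + (p * q + r * s) * (p - s)
      + (p^2 - q^2 + r^2 - s^2) / 2 * (- q - r)) = (p * s - q * r) * (r - q)"
    "(p * r + q * s) * (r - q) + (p * s + q * r) * (p - s) + (p * r - q * s) * (- q - r)
      = (p * s - q * r) * (p - s)"
    "((p^2 + q^2 - r^2 - s^2) / 2 * (r - q) + (p * q - r * s) * (p - s)
      + (p^2 - q^2 - r^2 + s^2) / 2 * (- q - r)) = (p * s - q * r) * (- q - r)"
    by (simp_all add: field_simps power2_eq_square)
  then show "adj_rep p q r s *v v = \<epsilon> *\<^sub>R v"
    unfolding vec_eq_iff forall_3 adj_rep_mult_vec v vector_scaleR_component ab
    unfolding d using D by simp
  \<comment> \<open>Minus the discriminant of the fixed-point quadratic, so positive exactly when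
    its roots are not real.\<close>
  show "Q v = 4 * (p * s - q * r) - (p + s)^2"
    by (simp add: Q_def lorentz_def v algebra_simps power2_eq_square)
qed

lemma rotatory_elliptic_adj_rep:
  assumes "p * s - q * r > 0" "(p + s)^2 < 4 * (p * s - q * r)"
  shows "rotatory_elliptic 1 (adj_rep p q r s)"
proof (rule rotatory_elliptic_1I)
  let ?D = "p * s - q * r"
  have d: "?D = 1 * ?D" by simp
  show "is_elliptic (adj_rep p q r s)"
    unfolding is_elliptic_def
  proof (intro exI conjI)
    show "adj_rep p q r s *v vector [r - q, p - s, - q - r] = 1 *\<^sub>R vector [r - q, p - s, - q - r]"
      by (rule adj_rep_eigenvector(1)[OF d disjI1[OF refl] assms(1)])
    show "0 < Q (vector [r - q, p - s, - q - r])"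
      unfolding adj_rep_eigenvector(2)[OF d disjI1[OF refl] assms(1)] using assms(2) by simp
  qed
  \<comment> \<open>The number in the role of \<alpha> is the cosine of the rotation angle; it
    equals -1 exactly for trace 0, the half-turn.\<close>
  show "charpoly (adj_rep p q r s) = [:-1, 1:] * [:1, - 2 * ((p + s)^2 / ?D / 2 - 1), 1:]"
  proof -
    have "- 2 * (x / 2 - 1) = - (x - 2 * 1)" for x :: real by simp
    then show ?thesis by (simp only: charpoly_adj_rep[OF d disjI1[OF refl] assms(1)])
  qed
  show "- 1 \<le> (p + s)^2 / ?D / 2 - 1" using assms(1) by simp
  show "(p + s)^2 / ?D / 2 - 1 < 1" using assms by (simp add: divide_less_eq)
qed

text \<open>A reflection. The vector of \<open>adj_rep_eigenvector\<close> is the normal of the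
  mirror here: it has eigenvalue -1 and \<open>Q v = 4 * (p * s - q * r) < 0\<close>, so ellipticity
  needs a vector in the mirror itself.\<close>

lemma rotatory_elliptic_inversion_adj_rep:
  assumes "p * s - q * r < 0" "p + s = 0"
  shows "rotatory_elliptic_inversion 0 (adj_rep p q r s)"
proof (rule rotatory_elliptic_inversion_0I)
  define D where "D = - (p * s - q * r)"
  have D: "D > 0" using assms by (simp add: D_def)
  have d: "p * s - q * r = -1 * D" by (simp add: D_def)
  show "charpoly (adj_rep p q r s) = [:-1, 1:]^2 * [:1, 1:]"
    using charpoly_adj_rep[OF d disjI2[OF refl] D] assms(2) by (simp add: power2_eq_square)
  have s: "s = - p" using assms(2) by simp
  have D': "D = p^2 + q * r" by (simp add: D_def s power2_eq_square)
  have ab: "\<bar>p * s - q * r\<bar> = D" using D d by simp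
  \<comment> \<open>The map is an involution, so the sum of a point and its image is fixed.\<close>
  define v :: "real^3" where "v = vector [p^2 + (q^2 + r^2) / 2 + D, p * r - p * q, (q^2 - r^2) / 2]"
  have v: "v$1 = p^2 + (q^2 + r^2) / 2 + D" "v$2 = p * r - p * q" "v$3 = (q^2 - r^2) / 2"
    by (simp_all add: v_def)
  have "(p^2 + q^2 + r^2 + s^2) / 2 * v$1 + (p * q + r * s) * v$2
      + (p^2 - q^2 + r^2 - s^2) / 2 * v$3 = D * v$1"
    "(p * r + q * s) * v$1 + (p * s + q * r) * v$2 + (p * r - q * s) * v$3 = D * v$2"
    "(p^2 + q^2 - r^2 - s^2) / 2 * v$1 + (p * q - r * s) * v$2
      + (p^2 - q^2 - r^2 + s^2) / 2 * v$3 = D * v$3"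
    unfolding v D' s by (simp_all add: field_simps power2_eq_square)
  then have "adj_rep p q r s *v v = 1 *\<^sub>R v"
    unfolding vec_eq_iff forall_3 adj_rep_mult_vec ab using D by simp
  moreover have "Q v > 0"
  proof -
    \<comment> \<open>\<open>v\<close> is \<open>D\<close> times the sum of the base point (1, 0, 0)
      and its image, so this is D^2 (2 + 2 cosh d) with d their distance.\<close>
    have "Q v = 2 * D^2 + 2 * D * p^2 + D * (q^2 + r^2)"
      unfolding Q_def lorentz_def v D' by (simp add: field_simps power2_eq_square)
    also have "\<dots> > 0" using D by (intro add_pos_nonneg) auto
    finally show ?thesis .
  qed
  ultimately show "is_elliptic (adj_rep p q r s)" unfolding is_elliptic_def by blast
qed

text \<open>A glide reflection. With \<epsilon> = -1 the sum of the roots of the quadratic factor is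
  (p + s)^2 / D + 2, which exceeds 2, so the factor has real roots x and 1/x different from
  1.\<close>

lemma rotatory_hyperbolic_inversion_adj_rep:
  assumes "p * s - q * r < 0" "p + s \<noteq> 0"
  shows "rotatory_hyperbolic_inversion 0 (adj_rep p q r s)"
proof -
  define D where "D = - (p * s - q * r)"
  have D: "D > 0" using assms by (simp add: D_def)
  have d: "p * s - q * r = -1 * D" by (simp add: D_def)
  have "(p + s)^2 / D > 0" using D assms(2) by simp
  then obtain x where x: "x > 1" "x + inverse x = (p + s)^2 / D + 2"
    using sum_with_inverse_surj[of "(p + s)^2 / D + 2"] by auto
  have "charpoly (adj_rep p q r s) = [:1, 1:] * [:1, - (x + inverse x), 1:]"
    using charpoly_adj_rep[OF d disjI2[OF refl] D] x(2) by simp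
  also have "[:1, - (x + inverse x), 1:] = [:- x, 1:] * [:- inverse x, 1:]"
    using x(1) by simp
  finally show ?thesis using x(1) by (intro rotatory_hyperbolic_inversion_0I) (simp_all only: mult_ac)
qed

section \<open>The two models of the plane\<close>

text \<open>The hypotheses on \<zeta> say that it is \<open>z\<close> for positive and
  \<open>cnj z\<close> for negative determinant, so one computation serves both orientations. In the
  coordinates \<open>n, y, m\<close> of a symmetric matrix the image is proportional to
  \<open>F, G, E\<close>, where F and E are the squared moduli of numerator and denominator and G is
  the real part of numerator times conjugate denominator.\<close>

lemma adj_rep_half_plane:
  assumes y: "Im z > 0" and d: "p * s - q * r \<noteq> 0" and x: "Re \<zeta> = Re z"
    and \<zeta>: "(p * s - q * r) * Im \<zeta> = \<bar>p * s - q * r\<bar> * Im z"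
  shows "\<exists>w\<in>points Half_Plane. moebius (mat2 (of_real p) (of_real q) (of_real r) (of_real s)) (Some \<zeta>) = Some w \<and>
    adj_rep p q r s *v to_hyperboloid Half_Plane z = to_hyperboloid Half_Plane w"
proof -
  define D where "D = \<bar>p * s - q * r\<bar>"
  have D: "D > 0" "D^2 = (p * s - q * r)^2" using d by (simp_all add: D_def)
  have "(p * s - q * r)^2 * (Im \<zeta>)^2 = (p * s - q * r)^2 * (Im z)^2"
    using \<zeta> unfolding D_def[symmetric] D(2)[symmetric]
    by (metis D(2) power_mult_distrib)
  then have \<zeta>2: "(Im \<zeta>)^2 = (Im z)^2" using d by simp
  \<comment> \<open>\<zeta> enters these only through its real part and the square of its imaginary
    part, so they can be written in terms of \<open>z\<close>.\<close>
  define E F G where "E = (r * Re z + s)^2 + r^2 * (Im z)^2"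
    and "F = (p * Re z + q)^2 + p^2 * (Im z)^2"
    and "G = (p * Re z + q) * (r * Re z + s) + p * r * (Im z)^2"
  have E: "E > 0"
  proof (cases "r = 0")
    case True
    then show ?thesis using d by (simp add: E_def)
  next
    case False
    then show ?thesis using y unfolding E_def by (intro add_nonneg_pos) auto
  qed
  define n m where "n = of_real p * \<zeta> + of_real q" and "m = of_real r * \<zeta> + of_real s"
  have nm: "Re n = p * Re z + q" "Im n = p * Im \<zeta>" "Re m = r * Re z + s" "Im m = r * Im \<zeta>"
    by (simp_all add: n_def m_def x)
  have mE: "(Re m)^2 + (Im m)^2 = E" and nF: "(Re n)^2 + (Im n)^2 = F"
    by (simp_all add: nm E_def F_def power_mult_distrib \<zeta>2)
  have m0: "m \<noteq> 0" using mE E by auto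
  define w where "w = n / m"
  have "Re n * Re m + Im n * Im m = G"
    using \<zeta>2 by (simp add: nm G_def power2_eq_square)
  then have w1: "Re w = G / E" by (simp add: w_def Re_divide mE)
  have "Im n * Re m - Re n * Im m = D * Im z"
    using \<zeta> by (simp add: nm D_def algebra_simps)
  then have w2: "Im w = D * Im z / E" by (simp add: w_def Im_divide mE)
  have w3: "(cmod w)^2 = F / E"
    by (simp add: w_def norm_divide power_divide cmod_power2[of n] cmod_power2[of m] mE nF)
  have "Im w > 0" using w2 D E y by simp
  moreover have "moebius (mat2 (of_real p) (of_real q) (of_real r) (of_real s)) (Some \<zeta>) = Some w"
    using m0 by (simp add: w_def n_def m_def)
  moreover have "adj_rep p q r s *v to_hyperboloid Half_Plane z = to_hyperboloid Half_Plane w"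
  proof -
    define v where "v = to_hyperboloid Half_Plane z"
    have v: "v$1 = ((cmod z)^2 + 1) / (2 * Im z)" "v$2 = 2 * Re z / (2 * Im z)" "v$3 = ((cmod z)^2 - 1) / (2 * Im z)"
      by (simp_all add: v_def)
    have lin: "a * (b / k) + a' * (b' / k) + a'' * (b'' / k) = (a * b + a' * b' + a'' * b'') / k"
      for a b a' b' a'' b'' k :: real
      by (simp add: add_divide_distrib)
    have "(p^2 + q^2 + r^2 + s^2) / 2 * ((cmod z)^2 + 1) + (p * q + r * s) * (2 * Re z)
        + (p^2 - q^2 + r^2 - s^2) / 2 * ((cmod z)^2 - 1) = F + E"
      "(p * r + q * s) * ((cmod z)^2 + 1) + (p * s + q * r) * (2 * Re z) + (p * r - q * s) * ((cmod z)^2 - 1) = 2 * G"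
      "(p^2 + q^2 - r^2 - s^2) / 2 * ((cmod z)^2 + 1) + (p * q - r * s) * (2 * Re z)
        + (p^2 - q^2 - r^2 + s^2) / 2 * ((cmod z)^2 - 1) = F - E"
      unfolding cmod_power2 E_def F_def G_def by (simp_all add: field_simps power2_eq_square)
    then have T: "(adj_rep p q r s *v v)$1 = (F + E) / (2 * Im z) / D"
      "(adj_rep p q r s *v v)$2 = 2 * G / (2 * Im z) / D"
      "(adj_rep p q r s *v v)$3 = (F - E) / (2 * Im z) / D"
      unfolding adj_rep_mult_vec D_def[symmetric] v lin by simp_all
    have "F / E + 1 = (F + E) / E" "F / E - 1 = (F - E) / E"
      using E by (simp_all add: field_simps)
    then show ?thesis
      unfolding v_def[symmetric] vec_eq_iff forall_3 T using E D y
      by (simp add: w1 w2 w3 mult.commute)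
  qed
  ultimately show ?thesis by auto
qed

lemma identified_half_plane_preserving:
  assumes "p * s - q * r > 0"
  shows "identified Half_Plane (moebius (mat2 (of_real p) (of_real q) (of_real r) (of_real s))) (adj_rep p q r s)"
  using assms by (intro identifiedI Q_adj_rep adj_rep_half_plane) simp_all

lemma identified_half_plane_reversing:
  assumes "p * s - q * r < 0"
  shows "identified Half_Plane (moebius (mat2 (of_real p) (of_real q) (of_real r) (of_real s)) \<circ> map_option cnj)
    (adj_rep p q r s)"
proof (rule identifiedI)
  fix z assume "z \<in> points Half_Plane"
  then show "\<exists>w\<in>points Half_Plane.
      (moebius (mat2 (of_real p) (of_real q) (of_real r) (of_real s)) \<circ> map_option cnj) (Some z) = Some w \<and>
      adj_rep p q r s *v to_hyperboloid Half_Plane z = to_hyperboloid Half_Plane w"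
    unfolding o_apply option.map
    by (intro adj_rep_half_plane) (use assms in \<open>simp_all add: abs_if algebra_simps\<close>)
qed (use assms in \<open>simp add: Q_adj_rep\<close>)

text \<open>Conjugation by the Cayley map \<open>z \<mapsto> (\<i> z + 1) / (z + \<i>)\<close>, which turns one
  \<^const>\<open>to_hyperboloid\<close> into the other, takes the matrix with rows \<open>a, cnj c\<close> and \<open>c, cnj a\<close>
  to the real matrix with rows \<open>Re a - Im c, Im a + Re c\<close> and \<open>Re c - Im a, Re a + Im c\<close>,
  and complex conjugation to \<open>z \<mapsto> 1 / cnj z\<close>.\<close>

lemma adj_rep_disk:
  assumes z: "z \<in> points Disk" and ac: "(cmod a)^2 - (cmod c)^2 = 1"
  shows "\<exists>w\<in>points Disk. moebius (mat2 a (cnj c) c (cnj a)) (Some z) = Some w \<and>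
    adj_rep (Re a - Im c) (Im a + Re c) (Re c - Im a) (Re a + Im c) *v to_hyperboloid Disk z = to_hyperboloid Disk w"
proof -
  define a1 a2 c1 c2 x y where r: "a1 = Re a" "a2 = Im a" "c1 = Re c" "c2 = Im c" "x = Re z" "y = Im z"
  define k where "k = 1 - (x^2 + y^2)"
  have "(cmod z)^2 < 1" using z by (auto simp: abs_square_less_1)
  then have k: "k > 0" by (simp add: k_def r cmod_power2)
  have one: "a1^2 + a2^2 - (c1^2 + c2^2) = 1" using ac by (simp add: r cmod_power2)
  define n m where "n = a * z + cnj c" and "m = c * z + cnj a"
  have nm: "Re n = a1 * x - a2 * y + c1" "Im n = a1 * y + a2 * x - c2"
    "Re m = c1 * x - c2 * y + a1" "Im m = c1 * y + c2 * x - a2"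
    by (simp_all add: n_def m_def r)
  \<comment> \<open>E and F are the squared moduli of \<open>m\<close> and \<open>n\<close>; G and H
    are the real and imaginary parts of \<open>n * cnj m\<close>.\<close>
  define E F G H where "E = (Re m)^2 + (Im m)^2" and "F = (Re n)^2 + (Im n)^2"
    and "G = Re n * Re m + Im n * Im m" and "H = Im n * Re m - Re n * Im m"
  \<comment> \<open>A matrix of SU(1,1) preserves the Hermitian form |m|^2 - |n|^2, whose value on
    the pair (z, 1) is 1 - |z|^2.\<close>
  have EF: "E - F = k"
    using one unfolding E_def F_def nm k_def by algebra
  have "F \<ge> 0" by (simp add: F_def)
  then have E: "E > 0" using EF k by linarith
  then have m0: "m \<noteq> 0" by (auto simp: E_def)
  define w where "w = n / m"
  have w: "Re w = G / E" "Im w = H / E" "(cmod w)^2 = F / E"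
    by (simp_all add: w_def Re_divide Im_divide norm_divide power_divide
        cmod_power2[of n] cmod_power2[of m] E_def F_def G_def H_def)
  have w4: "1 - (cmod w)^2 = k / E" "1 + (cmod w)^2 = (E + F) / E"
    using E EF by (simp_all add: w field_simps)
  have "1 - (cmod w)^2 > 0" unfolding w4 using k E by simp
  then have "w \<in> points Disk" by (simp add: abs_square_less_1)
  moreover have "moebius (mat2 a (cnj c) c (cnj a)) (Some z) = Some w"
    using m0 by (simp add: w_def n_def m_def)
  moreover have "adj_rep (Re a - Im c) (Im a + Re c) (Re c - Im a) (Re a + Im c) *v to_hyperboloid Disk z
      = to_hyperboloid Disk w"
  proof -
    define p q r s where pq: "p = a1 - c2" "q = a2 + c1" "r = c1 - a2" "s = a1 + c2"
    have "p * s - q * r = a1^2 + a2^2 - (c1^2 + c2^2)"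
      unfolding pq by (simp add: algebra_simps power2_eq_square)
    then have ab: "\<bar>p * s - q * r\<bar> = 1" using one by simp
    define v where "v = to_hyperboloid Disk z"
    have v: "v$1 = (1 + (x^2 + y^2)) / k" "v$2 = 2 * x / k" "v$3 = 2 * y / k"
      by (simp_all add: v_def k_def \<open>x = Re z\<close> \<open>y = Im z\<close> cmod_power2)
    have lin: "a * (b / k) + a' * (b' / k) + a'' * (b'' / k) = (a * b + a' * b' + a'' * b'') / k"
      for a b a' b' a'' b'' k :: real
      by (simp add: add_divide_distrib)
    have "(p^2 + q^2 + r^2 + s^2) / 2 * (1 + (x^2 + y^2)) + (p * q + r * s) * (2 * x)
        + (p^2 - q^2 + r^2 - s^2) / 2 * (2 * y) = E + F"
      "(p * r + q * s) * (1 + (x^2 + y^2)) + (p * s + q * r) * (2 * x) + (p * r - q * s) * (2 * y) = 2 * G"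
      "(p^2 + q^2 - r^2 - s^2) / 2 * (1 + (x^2 + y^2)) + (p * q - r * s) * (2 * x)
        + (p^2 - q^2 - r^2 + s^2) / 2 * (2 * y) = 2 * H"
      unfolding E_def F_def G_def H_def nm pq by (simp_all add: field_simps power2_eq_square)
    then have T: "(adj_rep p q r s *v v)$1 = (E + F) / k" "(adj_rep p q r s *v v)$2 = 2 * G / k"
      "(adj_rep p q r s *v v)$3 = 2 * H / k"
      unfolding adj_rep_mult_vec ab v lin by simp_all
    have "adj_rep p q r s *v v = to_hyperboloid Disk w"
      unfolding vec_eq_iff forall_3 T using E k by (simp add: w4 w(1,2))
    then show ?thesis by (simp add: v_def pq \<open>a1 = Re a\<close> \<open>a2 = Im a\<close> \<open>c1 = Re c\<close> \<open>c2 = Im c\<close>)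
  qed
  ultimately show ?thesis by blast
qed

lemma det_disk:
  assumes "(cmod a)^2 - (cmod c)^2 = 1"
  shows "(Re a - Im c) * (Re a + Im c) - (Im a + Re c) * (Re c - Im a) = 1"
  using assms unfolding cmod_power2 by (simp add: algebra_simps power2_eq_square)

lemma identified_disk_preserving:
  assumes "(cmod a)^2 - (cmod c)^2 = 1"
  shows "identified Disk (moebius (mat2 a (cnj c) c (cnj a)))
    (adj_rep (Re a - Im c) (Im a + Re c) (Re c - Im a) (Re a + Im c))"
  using assms det_disk[OF assms] by (intro identifiedI Q_adj_rep adj_rep_disk) simp_all

text \<open>Exchanging the columns of the real matrix amounts to changing the sign of
  \<open>v$3\<close> first, which is complex conjugation in the disk; it also turns the determinant
  into -1.\<close>

lemma identified_disk_reversing: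
  assumes "(cmod a)^2 - (cmod c)^2 = 1"
  shows "identified Disk (moebius (mat2 a (cnj c) c (cnj a)) \<circ> map_option cnj)
    (adj_rep (Im a + Re c) (Re a - Im c) (Re a + Im c) (Re c - Im a))"
proof (rule identifiedI)
  fix z assume z: "z \<in> points Disk"
  have "adj_rep q p s r *v to_hyperboloid Disk z = adj_rep p q r s *v to_hyperboloid Disk (cnj z)" for p q r s
  proof -
    have "\<bar>q * r - p * s\<bar> = \<bar>p * s - q * r\<bar>" by (rule abs_minus_commute)
    then show ?thesis
      unfolding vec_eq_iff forall_3 adj_rep_mult_vec by (simp add: algebra_simps diff_divide_distrib)
  qed
  then show "\<exists>w\<in>points Disk. (moebius (mat2 a (cnj c) c (cnj a)) \<circ> map_option cnj) (Some z) = Some w \<and>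
      adj_rep (Im a + Re c) (Re a - Im c) (Re a + Im c) (Re c - Im a) *v to_hyperboloid Disk z = to_hyperboloid Disk w"
    using adj_rep_disk[OF _ assms, of "cnj z"] z by simp
qed (use det_disk[OF assms] in \<open>simp add: Q_adj_rep algebra_simps\<close>)

section \<open>The classification\<close>

text \<open>The fixed points satisfy \<gamma> |z|^2 - 2 Re (z cnj \<alpha>) - \<beta> = 0, a circle
  or, for \<gamma> = 0, a line; the positivity assumption makes it nondegenerate.\<close>

lemma inversion_in_moebius_cnj:
  fixes \<alpha> :: complex and \<beta> \<gamma> :: real
  assumes "(cmod \<alpha>)^2 + \<beta> * \<gamma> > 0"
  shows "\<exists>C. inversion_in C (moebius (mat2 \<alpha> (of_real \<beta>) (of_real \<gamma>) (- cnj \<alpha>)) \<circ> map_option cnj)"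
proof (cases "\<gamma> = 0")
  case True
  then have \<alpha>: "\<alpha> \<noteq> 0" using assms by auto
  define u where "u = \<i> * sgn \<alpha>"
  define p where "p = - of_real \<beta> / (2 * cnj \<alpha>)"
  have u: "cmod u = 1" using \<alpha> by (simp add: u_def norm_mult norm_sgn)
  have "u^2 = - (\<alpha>^2 / (of_real (cmod \<alpha>))^2)"
    by (simp add: u_def power_mult_distrib sgn_eq power_divide)
  also have "\<dots> = - (\<alpha> / cnj \<alpha>)"
    using \<alpha> by (simp add: power2_eq_square complex_norm_square[unfolded power2_eq_square] flip: of_real_mult)
  finally have u2: "u^2 = - (\<alpha> / cnj \<alpha>)" .
  have "moebius (mat2 \<alpha> (of_real \<beta>) (of_real \<gamma>) (- cnj \<alpha>)) \<circ> map_option cnj = map_option (\<lambda>z. p + u^2 * cnj (z - p))"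
  proof
    fix x show "(moebius (mat2 \<alpha> (of_real \<beta>) (of_real \<gamma>) (- cnj \<alpha>)) \<circ> map_option cnj) x
        = map_option (\<lambda>z. p + u^2 * cnj (z - p)) x"
      using \<alpha> by (cases x) (simp_all add: True u2 p_def field_simps)
  qed
  then show ?thesis using inversion_in.line[OF u, of p] by auto
next
  case False
  \<comment> \<open>Centre and radius result from completing the square in the equation of the
    circle.\<close>
  define p where "p = \<alpha> / of_real \<gamma>"
  define \<rho> where "\<rho> = sqrt ((cmod \<alpha>)^2 + \<beta> * \<gamma>) / \<bar>\<gamma>\<bar>"
  have \<rho>: "\<rho> > 0" using assms False by (simp add: \<rho>_def)
  have "\<rho>^2 = ((cmod \<alpha>)^2 + \<beta> * \<gamma>) / \<gamma>^2" using assms by (simp add: \<rho>_def power_divide)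
  then have "complex_of_real (\<rho>^2) = of_real ((cmod \<alpha>)^2 + \<beta> * \<gamma>) / of_real (\<gamma>^2)"
    by simp
  then have \<rho>2: "complex_of_real (\<rho>^2) = (\<alpha> * cnj \<alpha> + of_real \<beta> * of_real \<gamma>) / (of_real \<gamma>)^2"
    using complex_norm_square[of \<alpha>] by simp
  have "moebius (mat2 \<alpha> (of_real \<beta>) (of_real \<gamma>) (- cnj \<alpha>)) \<circ> map_option cnj =
      (\<lambda>w. case w of None \<Rightarrow> Some p
          | Some z \<Rightarrow> if z = p then None else Some (p + of_real (\<rho>^2) / cnj (z - p)))"
  proof
    fix x show "(moebius (mat2 \<alpha> (of_real \<beta>) (of_real \<gamma>) (- cnj \<alpha>)) \<circ> map_option cnj) x =
      (case x of None \<Rightarrow> Some p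
          | Some z \<Rightarrow> if z = p then None else Some (p + of_real (\<rho>^2) / cnj (z - p)))"
    proof (cases x)
      case None
      then show ?thesis using False by (simp add: p_def)
    next
      case (Some z)
      define g where "g = complex_of_real \<gamma>"
      have g: "g \<noteq> 0" "cnj g = g" using False by (simp_all add: g_def)
      define m where "m = g * cnj z - cnj \<alpha>"
      have m: "cnj (z - p) = m / g" using g by (simp add: p_def m_def diff_divide_distrib flip: g_def)
      have "m = 0 \<longleftrightarrow> z = p"
        using m g by (metis complex_cnj_zero_iff divide_eq_0_iff right_minus_eq)
      moreover have "(\<alpha> * cnj z + of_real \<beta>) / m = p + of_real (\<rho>^2) / (m / g)" if "m \<noteq> 0"
      proof -
        have "\<alpha> * m + (\<alpha> * cnj \<alpha> + of_real \<beta> * g) = g * (\<alpha> * cnj z + of_real \<beta>)"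
          by (simp add: m_def algebra_simps)
        then have "(\<alpha> * cnj z + of_real \<beta>) / m = (\<alpha> * m + (\<alpha> * cnj \<alpha> + of_real \<beta> * g)) / (g * m)"
          using g by simp
        also have "\<dots> = \<alpha> / g + ((\<alpha> * cnj \<alpha> + of_real \<beta> * g) / g^2) / (m / g)"
          using g that by (simp add: field_simps power2_eq_square)
        finally show ?thesis unfolding \<rho>2 p_def g_def .
      qed
      moreover have "(moebius (mat2 \<alpha> (of_real \<beta>) (of_real \<gamma>) (- cnj \<alpha>)) \<circ> map_option cnj) (Some z) =
          (if m = 0 then None else Some ((\<alpha> * cnj z + of_real \<beta>) / m))"
        by (simp add: m_def g_def)
      ultimately show ?thesis unfolding Some option.case m by simp
    qed
  qed
  then show ?thesis using inversion_in.circle[OF \<rho>, of p] by auto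
qed

text \<open>c is a real number x >= 0, so |x - 2| = 2 leaves only 0 and 4. The value 0 belongs to a
  half-turn, and the rotation argument, which needs just x < 4, covers it.\<close>

lemma preserving_classification:
  assumes id: "identified X (moebius A) (adj_rep p q r s)" and d: "p * s - q * r > 0"
    and A: "det A \<noteq> 0" "c_inv A = of_real ((p + s)^2 / (p * s - q * r))"
  shows "(cmod (c_inv A - 2) < 2 \<longrightarrow> is_rotatory_elliptic X 1 (moebius A)) \<and>
       (cmod (c_inv A - 2) > 2 \<longrightarrow> is_stretch (moebius A)) \<and>
       (cmod (c_inv A - 2) = 2 \<and> \<not> is_scalar A \<longrightarrow>
          (if c_inv A = 0 then is_rotatory_elliptic X 1 (moebius A) else is_translation (moebius A))) \<and>
       (cmod (c_inv A - 2) = 2 \<and> is_scalar A \<longrightarrow> moebius A = id)"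
proof -
  define x where "x = (p + s)^2 / (p * s - q * r)"
  have c: "c_inv A = of_real x" using A(2) by (simp add: x_def)
  have n: "cmod (c_inv A - 2) = \<bar>x - 2\<bar>"
    unfolding c by (metis norm_of_real of_real_diff of_real_numeral)
  have x0: "x \<ge> 0" using d by (simp add: x_def)
  have ell: "is_rotatory_elliptic X 1 (moebius A)" if "x < 4"
  proof -
    have "(p + s)^2 < 4 * (p * s - q * r)" using that d by (simp add: x_def divide_less_eq)
    then show ?thesis
      unfolding is_rotatory_elliptic_def using id rotatory_elliptic_adj_rep[OF d] by blast
  qed
  moreover have "is_stretch (moebius A)" if "x > 4" using is_stretch_moebius[OF A(1) c that] .
  moreover have "is_translation (moebius A)" if "x = 4" "\<not> is_scalar A"
    using is_translation_moebius[OF A(1) _ that(2)] c that(1) by simp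
  moreover have "moebius A = id" if "is_scalar A" using moebius_scalar[OF that A(1)] .
  moreover have "\<bar>x - 2\<bar> < 2 \<Longrightarrow> x < 4" "\<bar>x - 2\<bar> > 2 \<Longrightarrow> x > 4" "\<bar>x - 2\<bar> = 2 \<Longrightarrow> x = 0 \<or> x = 4"
    using x0 by (auto simp: abs_if split: if_splits)
  moreover have "c_inv A = 0 \<longleftrightarrow> x = 0" by (simp add: c)
  ultimately show ?thesis unfolding n by auto
qed

lemma reversing_classification:
  assumes id: "identified X f (adj_rep p q r s)" and d: "p * s - q * r < 0"
    and c: "c_inv B = of_real (((p + s)^2 / (p * s - q * r) - 2)^2)"
    and sc: "is_scalar B \<longleftrightarrow> p + s = 0"
    and inv: "p + s = 0 \<Longrightarrow> \<exists>C. inversion_in C f"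
  shows "(cmod (c_inv B - 2) > 2 \<longrightarrow> is_rotatory_hyperbolic_inversion X 0 f) \<and>
         (\<not> is_scalar B \<and> cmod (c_inv B - 2) < 2 \<longrightarrow> is_rotatory_elliptic_inversion X 1 f) \<and>
         (is_scalar B \<longrightarrow>
            is_rotatory_elliptic_inversion X 0 f \<and> (\<exists>C. inversion_in C f))"
proof -
  define y where "y = (p + s)^2 / (p * s - q * r)"
  have n: "cmod (c_inv B - 2) = \<bar>(y - 2)^2 - 2\<bar>"
    unfolding c y_def[symmetric] by (metis norm_of_real of_real_diff of_real_numeral)
  have "y \<le> 0" using d by (simp add: y_def divide_nonneg_neg)
  then have "2^2 \<le> (2 - y)^2" by (intro power_mono) auto
  then have ge: "\<bar>(y - 2)^2 - 2\<bar> \<ge> 2" by (simp add: power2_commute)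
  show ?thesis
  proof (cases "p + s = 0")
    case True
    then have "\<bar>(y - 2)^2 - 2\<bar> = 2" by (simp add: y_def)
    moreover have "is_rotatory_elliptic_inversion X 0 f"
      unfolding is_rotatory_elliptic_inversion_def
      using id rotatory_elliptic_inversion_adj_rep[OF d True] by blast
    ultimately show ?thesis using True sc inv n by simp
  next
    case False
    have "is_rotatory_hyperbolic_inversion X 0 f"
      unfolding is_rotatory_hyperbolic_inversion_def
      using id rotatory_hyperbolic_inversion_adj_rep[OF d False] by blast
    then show ?thesis using False sc ge n by simp
  qed
qed

section \<open>Matrix entries, and the matrix B of a reversing map, in each group\<close>

lemma GL2_realE:
  assumes "A \<in> GL2_real"
  obtains p q r s where "A = mat2 (of_real p) (of_real q) (of_real r) (of_real s)" "p * s - q * r \<noteq> 0"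
    "det A = of_real (p * s - q * r)"
proof -
  have R: "A$i$j = of_real (Re (A$i$j))" for i j
    using assms by (simp add: GL2_real_def)
  have A: "A = mat2 (of_real (Re (A$1$1))) (of_real (Re (A$1$2))) (of_real (Re (A$2$1))) (of_real (Re (A$2$2)))"
    using mat2_eta[of A] R by metis
  have d: "det A = of_real (Re (A$1$1) * Re (A$2$2) - Re (A$1$2) * Re (A$2$1))"
    by (subst A) (simp add: det_mat2)
  have "det A \<noteq> 0" using assms by (simp add: GL2_real_def)
  with A d show ?thesis using that by (metis of_real_0)
qed

lemma pos_SU11E:
  assumes "A \<in> pos_SU11"
  obtains t a c where "t > 0" "(cmod a)^2 - (cmod c)^2 = 1"
    "A = mat2 (of_real t * a) (of_real t * cnj c) (of_real t * c) (of_real t * cnj a)"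
proof -
  obtain t a c where "t > 0" "(cmod a)^2 - (cmod c)^2 = 1"
    "A = t *\<^sub>R vector [vector [a, cnj c], vector [c, cnj a]]"
    using assms by (auto simp: pos_SU11_def SU11_def)
  moreover from this(3) have "A = mat2 (of_real t * a) (of_real t * cnj c) (of_real t * c) (of_real t * cnj a)"
    by (simp add: vec_eq_iff forall_2 complex_eq_iff)
  ultimately show ?thesis using that by blast
qed

text \<open>For real \<open>A\<close> the product is A^2 = (trace A) A - (det A) I by
  Cayley-Hamilton. It is scalar only if the trace vanishes, because a real scalar matrix
  \<open>A\<close> would have positive determinant. Trace 0 is the shape treated in
  \<open>inversion_in_moebius_cnj\<close>.\<close>

lemma half_plane_reversing:
  assumes d: "p * s - q * r < 0"
  defines "A \<equiv> mat2 (of_real p) (of_real q) (of_real r) (of_real s)"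
  shows "c_inv (A ** matrix_cnj A) = of_real (((p + s)^2 / (p * s - q * r) - 2)^2)"
    and "is_scalar (A ** matrix_cnj A) \<longleftrightarrow> p + s = 0"
    and "p + s = 0 \<Longrightarrow> \<exists>C. inversion_in C (moebius A \<circ> map_option cnj)"
proof -
  let ?d = "p * s - q * r"
  have B: "A ** matrix_cnj A = mat2 (of_real (p * p + q * r)) (of_real (q * (p + s)))
      (of_real (r * (p + s))) (of_real (r * q + s * s))"
    unfolding A_def matrix_cnj_mat2 mat2_mult by (simp add: algebra_simps)
  have "p * p + q * r + (r * q + s * s) = (p + s)^2 - 2 * ?d"
    "(p * p + q * r) * (r * q + s * s) - q * (p + s) * (r * (p + s)) = ?d^2"
    by (simp_all add: algebra_simps power2_eq_square)
  then have "c_inv (A ** matrix_cnj A) = of_real (((p + s)^2 - 2 * ?d)^2 / ?d^2)"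
    unfolding B c_inv_mat2 by (simp only: flip: of_real_add of_real_mult of_real_diff of_real_power of_real_divide)
  also have "((p + s)^2 - 2 * ?d)^2 / ?d^2 = ((p + s)^2 / ?d - 2)^2"
  proof -
    have "x / e - 2 = (x - 2 * e) / e" if "e \<noteq> 0" for x e :: real
      using that by (simp add: diff_divide_distrib)
    from this[of ?d "(p + s)^2"] show ?thesis using d by (simp only: power_divide)
  qed
  finally show "c_inv (A ** matrix_cnj A) = of_real (((p + s)^2 / ?d - 2)^2)" .
  have "p * p + q * r = r * q + s * s \<longleftrightarrow> (p + s) * (p - s) = 0" by (simp add: algebra_simps)
  moreover have "p + s = 0" if "p - s = 0" "q = 0 \<or> p + s = 0" "r = 0 \<or> p + s = 0"
    using that d by auto
  ultimately show "is_scalar (A ** matrix_cnj A) \<longleftrightarrow> p + s = 0"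
    unfolding B is_scalar_mat2 of_real_eq_iff of_real_eq_0_iff mult_eq_0_iff by blast
  show "\<exists>C. inversion_in C (moebius A \<circ> map_option cnj)" if "p + s = 0"
  proof -
    have s: "s = - p" using that by simp
    have "(cmod (of_real p))^2 + q * r > 0" using d by (simp add: s power2_eq_square)
    from inversion_in_moebius_cnj[OF this] show ?thesis by (simp add: A_def s)
  qed
qed

text \<open>\<open>2 * Re c\<close> is the trace of the column-exchanged real matrix, whose
  determinant is -1; the formulas thus agree with those for the half-plane.\<close>

lemma disk_reversing:
  assumes ac: "(cmod a)^2 - (cmod c)^2 = 1" and t: "t > 0"
  defines "A \<equiv> mat2 (of_real t * a) (of_real t * cnj c) (of_real t * c) (of_real t * cnj a)"
  shows "c_inv (A ** matrix_cnj A) = of_real ((4 * (Re c)^2 + 2)^2)"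
    and "is_scalar (A ** matrix_cnj A) \<longleftrightarrow> Re c = 0"
    and "Re c = 0 \<Longrightarrow> \<exists>C. inversion_in C (moebius A \<circ> map_option cnj)"
proof -
  define T where "T = (of_real t :: complex)^2"
  have T: "T \<noteq> 0" using t by (simp add: T_def)
  have a0: "a \<noteq> 0" 
  proof
    assume "a = 0"
    then have "(cmod c)^2 = - 1" using ac by simp
    then show False using zero_le_power2[of "cmod c"] by linarith
  qed
  have one: "a * cnj a = 1 + c * cnj c"
    using ac complex_norm_square[of a] complex_norm_square[of c] by (metis diff_eq_eq of_real_1 of_real_add)
  have c2: "c + cnj c = 2 * of_real (Re c)" by (simp add: complex_add_cnj)
  have B: "A ** matrix_cnj A = mat2 (T * (a * cnj a + cnj c * cnj c)) (T * (a * (c + cnj c)))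
      (T * (cnj a * (c + cnj c))) (T * (a * cnj a + c * c))"
    unfolding A_def matrix_cnj_mat2 mat2_mult T_def by (simp add: algebra_simps power2_eq_square)
  have "T * (a * cnj a + cnj c * cnj c) + T * (a * cnj a + c * c) = T * ((c + cnj c)^2 + 2)"
    "T * (a * cnj a + cnj c * cnj c) * (T * (a * cnj a + c * c))
       - T * (a * (c + cnj c)) * (T * (cnj a * (c + cnj c))) = T^2"
    using one by algebra+
  then have "c_inv (A ** matrix_cnj A) = (T * ((c + cnj c)^2 + 2))^2 / T^2"
    unfolding B c_inv_mat2 by simp
  also have "\<dots> = ((c + cnj c)^2 + 2)^2" using T by (simp add: power_mult_distrib)
  finally show "c_inv (A ** matrix_cnj A) = of_real ((4 * (Re c)^2 + 2)^2)"
    by (simp add: c2 power_mult_distrib)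
  have "cnj c * cnj c = c * c" if "c + cnj c = 0" using that by algebra
  moreover have "c + cnj c = 0 \<longleftrightarrow> Re c = 0" by (simp add: c2)
  ultimately show "is_scalar (A ** matrix_cnj A) \<longleftrightarrow> Re c = 0"
    unfolding B is_scalar_mat2 using T a0 by auto
  show "\<exists>C. inversion_in C (moebius A \<circ> map_option cnj)" if "Re c = 0"
  proof -
    have c: "c = \<i> * of_real (Im c)" using that by (simp add: complex_eq_iff)
    \<comment> \<open>Multiplying the matrix by -i does not change its map; since \<open>c\<close>
      is purely imaginary, it makes the off-diagonal entries real and gives the shape of
      \<open>inversion_in_moebius_cnj\<close>.\<close>
    have "(cmod (- \<i> * a))^2 + (- Im c) * Im c > 0"
    proof -
      have "(cmod c)^2 = (Im c)^2" using that by (simp add: cmod_power2)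
      then show ?thesis using ac by (simp add: norm_mult power2_eq_square)
    qed
    from inversion_in_moebius_cnj[OF this]
    obtain C where C: "inversion_in C (moebius (mat2 (- \<i> * a) (of_real (- Im c)) (of_real (Im c)) (- cnj (- \<i> * a))) \<circ> map_option cnj)"
      by blast
    have ci: "- \<i> * c = of_real (Im c)" "- \<i> * cnj c = - of_real (Im c)"
      using that by (simp_all add: complex_eq_iff)
    have "moebius A = moebius (mat2 a (cnj c) c (cnj a))"
      unfolding A_def using t by (simp add: moebius_mat2_scale)
    also have "\<dots> = moebius (mat2 (- \<i> * a) (- \<i> * cnj c) (- \<i> * c) (- \<i> * cnj a))"
      by (rule moebius_mat2_scale[symmetric]) simp
    also have "\<dots> = moebius (mat2 (- \<i> * a) (of_real (- Im c)) (of_real (Im c)) (- cnj (- \<i> * a)))"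
      unfolding ci by simp
    finally show ?thesis using C by auto
  qed
qed

theorem corollary2:
  fixes X :: model and A :: "complex^2^2" and f :: "riemann_sphere \<Rightarrow> riemann_sphere"
  assumes "induces_preserving X A f \<or> induces_reversing X A f"
  shows "c_inv A \<in> \<real> \<and>
    (induces_preserving X A f \<longrightarrow>
       (cmod (c_inv A - 2) < 2 \<longrightarrow> is_rotatory_elliptic X 1 f) \<and>
       (cmod (c_inv A - 2) > 2 \<longrightarrow> is_stretch f) \<and>
       (cmod (c_inv A - 2) = 2 \<and> \<not> is_scalar A \<longrightarrow>
          (if c_inv A = 0 then is_rotatory_elliptic X 1 f else is_translation f)) \<and>
       (cmod (c_inv A - 2) = 2 \<and> is_scalar A \<longrightarrow> f = id)) \<and>
    (induces_reversing X A f \<longrightarrow>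
       (let B = A ** matrix_cnj A in
         (cmod (c_inv B - 2) > 2 \<longrightarrow> is_rotatory_hyperbolic_inversion X 0 f) \<and>
         (\<not> is_scalar B \<and> cmod (c_inv B - 2) < 2 \<longrightarrow> is_rotatory_elliptic_inversion X 1 f) \<and>
         (is_scalar B \<longrightarrow>
            is_rotatory_elliptic_inversion X 0 f \<and> (\<exists>C. inversion_in C f))))"
proof -
  let ?B = "A ** matrix_cnj A"
  consider "X = Half_Plane" "A \<in> GL2_real" | "X = Disk" "A \<in> pos_SU11"
    using assms by (cases X) auto
  \<comment> \<open>This collects exactly what the two model-independent classification lemmas
    require, so that the models play no part afterwards.\<close>
  then have "c_inv A \<in> \<real> \<and> (induces_preserving X A f \<longrightarrow>
      f = moebius A \<and> (\<exists>p q r s. identified X (moebius A) (adj_rep p q r s) \<and> p * s - q * r > 0 \<and>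
      det A \<noteq> 0 \<and> c_inv A = of_real ((p + s)^2 / (p * s - q * r)))) \<and>
    (induces_reversing X A f \<longrightarrow>
      (\<exists>p q r s. identified X f (adj_rep p q r s) \<and> p * s - q * r < 0 \<and>
      c_inv ?B = of_real (((p + s)^2 / (p * s - q * r) - 2)^2) \<and>
      (is_scalar ?B \<longleftrightarrow> p + s = 0) \<and> (p + s = 0 \<longrightarrow> (\<exists>C. inversion_in C f))))"
  proof cases
    case 1
    from 1(2) obtain p q r s where A: "A = mat2 (of_real p) (of_real q) (of_real r) (of_real s)"
      and d: "p * s - q * r \<noteq> 0" "det A = of_real (p * s - q * r)"
      by (rule GL2_realE)
    have c: "c_inv A = of_real ((p + s)^2 / (p * s - q * r))"
      by (simp add: A c_inv_mat2)
    have "f = moebius A \<and> identified X (moebius A) (adj_rep p q r s) \<and> p * s - q * r > 0"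
      if "induces_preserving X A f"
    proof -
      have "p * s - q * r > 0" "f = moebius A" using that 1 d(2) by simp_all
      then show ?thesis using identified_half_plane_preserving 1 A by simp
    qed
    moreover have "identified X f (adj_rep p q r s) \<and> p * s - q * r < 0 \<and>
        c_inv ?B = of_real (((p + s)^2 / (p * s - q * r) - 2)^2) \<and>
        (is_scalar ?B \<longleftrightarrow> p + s = 0) \<and> (p + s = 0 \<longrightarrow> (\<exists>C. inversion_in C f))"
      if "induces_reversing X A f"
    proof -
      have "p * s - q * r < 0" "f = moebius A \<circ> map_option cnj" using that 1 d(2) by simp_all
      then show ?thesis
        using identified_half_plane_reversing half_plane_reversing 1(1) A by metis
    qed
    moreover have "det A \<noteq> 0" unfolding d(2) using d(1) by (simp only: of_real_eq_0_iff not_False_eq_True)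
    moreover have "c_inv A \<in> \<real>" by (simp add: c)
    ultimately show ?thesis using c by blast
  next
    case 2
    from 2(2) obtain t a c where t: "t > 0" and ac: "(cmod a)^2 - (cmod c)^2 = 1"
      and A: "A = mat2 (of_real t * a) (of_real t * cnj c) (of_real t * c) (of_real t * cnj a)"
      by (rule pos_SU11E)
    let ?p = "Re a - Im c" and ?q = "Im a + Re c" and ?r = "Re c - Im a" and ?s = "Re a + Im c"
    note d = det_disk[OF ac]
    have m: "moebius A = moebius (mat2 a (cnj c) c (cnj a))"
      unfolding A using t by (simp add: moebius_mat2_scale)
    define T where "T = (of_real t :: complex)"
    have T: "T \<noteq> 0" using t by (simp add: T_def)
    have one: "a * cnj a - cnj c * c = 1"
      using ac complex_norm_square[of a] complex_norm_square[of c]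
      by (metis mult.commute of_real_1 of_real_diff)
    have det: "T * a * (T * cnj a) - T * cnj c * (T * c) = T^2"
      using one by algebra
    have "c_inv A = (T * (a + cnj a))^2 / T^2"
      unfolding A c_inv_mat2 T_def[symmetric] det by (simp add: distrib_left)
    also have "\<dots> = (a + cnj a)^2" using T by (simp add: power_mult_distrib)
    finally have c: "c_inv A = of_real ((?p + ?s)^2 / (?p * ?s - ?q * ?r))"
      unfolding d by (simp add: complex_add_cnj)
    have "det A \<noteq> 0" unfolding A det_mat2 T_def[symmetric] det using T by simp
    moreover have "f = moebius A" if "induces_preserving X A f" using that 2 by simp
    moreover have "identified X (moebius A) (adj_rep ?p ?q ?r ?s)"
      unfolding m using identified_disk_preserving[OF ac] 2 by simp
    moreover have "?p * ?s - ?q * ?r > 0" unfolding d by simp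
    moreover have "identified X f (adj_rep ?q ?p ?s ?r) \<and> ?q * ?r - ?p * ?s < 0 \<and>
        c_inv ?B = of_real (((?q + ?r)^2 / (?q * ?r - ?p * ?s) - 2)^2) \<and>
        (is_scalar ?B \<longleftrightarrow> ?q + ?r = 0) \<and> (?q + ?r = 0 \<longrightarrow> (\<exists>C. inversion_in C f))"
      if "induces_reversing X A f"
    proof -
      have f: "f = moebius A \<circ> map_option cnj" using that 2 by simp
      have d': "?q * ?r - ?p * ?s = - 1" using d by simp
      have e: "?q + ?r = 2 * Re c" by simp
      have e': "((2 * Re c)^2 / (- 1) - 2)^2 = (4 * (Re c)^2 + 2)^2"
        by (simp add: power2_eq_square algebra_simps)
      note R = disk_reversing[OF ac t, folded A]
      show ?thesis
        unfolding d' e e' using identified_disk_reversing[OF ac] 2(1) R f m by simp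
    qed
    moreover have "c_inv A \<in> \<real>" unfolding c by (rule Reals_of_real)
    ultimately show ?thesis using c by blast
  qed
  then show ?thesis
    unfolding Let_def using preserving_classification reversing_classification by metis
qed

end
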